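(* Let $n\ge 3$ and let $L=(l_1,\dots,l_n)$ be a sequence of pairwise different positive real numbers. Consider the swap action of the group $F_n^0$ on the moduli spaces $M_2(L)$ and $M_3(L)$. Then the critical points of the signed area function $A$ on $M_2(L)$, and the critical points $P$ with $S(P)\ne0$ of the vector area function $S$ on $M_3(L)$, are stable under the action of $F_n^0$; that is, each such critical point $P$ satisfies $gP=P$ for every $g\in F_n^0$.
   Context: All indices are taken modulo $n$ (so $n+1=1$). Moduli space: for a sequence $L=(l_1,\dots,l_n)$ of positive numbers (a polygonal $n$-linkage), a configuration in $\mathbb{R}^d$ is a sequence of points $P=(p_1,\dots,p_n)$, $p_i\in\mathbb{R}^d$, with $|p_ip_{i+1}|=l_i$ for all $i$. $M_d(L)$ is the set of all configurations modulo the action of orientation preserving isometries of $\mathbb{R}^d$. For $d=2,3$ it is a smooth manifold away from the collinear configurations, and critical points are understood at points where $M_d(L)$ is smooth (non-collinear configurations). Area functions: the signed area of $P\subset\mathbb{R}^2$ with $p_i=(x_i,y_i)$ is given by $2A(P)=(x_1y_2-x_2y_1)+\dots+(x_ny_1-x_1y_n)$. The vector area of $P\subset\mathbb{R}^3$ is $\overrightarrow{S(P)}$ with $2\overrightarrow{S(P)}=p_1\times p_2+p_2\times p_3+\dots+p_n\times p_1$, and $S(P)=|\overrightarrow{S(P)}|$. These define functions $A$ on $M_2(L)$ and $S$ on $M_3(L)$. Swaps: for a configuration $P$, the polygon $s_i(P)$ is obtained from $P$ by transposing the two edges adjacent to the vertex $p_i$: all vertices other than $p_i$ stay fixed, and $p_i$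 is replaced by its mirror image in the perpendicular bisector (a line if $d=2$, a plane if $d=3$) of the segment $p_{i-1}p_{i+1}$; so for $d=3$ the new pair of edges lies in the plane spanned by the old pair. (Since the edge lengths are pairwise different, $p_{i-1}\ne p_{i+1}$.) Let $\sigma_i\in S_n$ be the transposition $(i-1\;\,i)$ of the positions of the two edges adjacent to $p_i$. Then $s_i$ induces homeomorphisms $M_d(L')\to M_d(\sigma_iL')$ for every $L'$ obtained from $L$ by permuting its entries. Groups: $F_n$ is the free group on the symbols $s_1,\dots,s_n$; it acts on the disjoint union $\bigsqcup_{\sigma\in S_n}M_d(\sigma L)$ by swaps. $\pi\colon F_n\to S_n$ is the homomorphism with $\pi(s_i)=\sigma_i$, and $F_n^0=\ker\pi$; the group $F_n^0$ acts on $M_d(L)$. *)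

theory Defs
  imports "HOL-Analysis.Analysis" "HOL-Algebra.Sym_Groups" "HOL-Algebra.Group_Action"
begin

section \<open>Free groups\<close>

text \<open>The letter \<open>(a, True)\<close> stands for the generator \<open>a\<close>, the letter \<open>(a, False)\<close> for its
  inverse. Elements of the free group are the freely reduced words.\<close>

definition inv_letter :: "'a \<times> bool \<Rightarrow> 'a \<times> bool" where
  "inv_letter x = (fst x, \<not> snd x)"

definition reduced_word :: "('a \<times> bool) list \<Rightarrow> bool" where
  "reduced_word w \<longleftrightarrow> successively (\<lambda>x y. y \<noteq> inv_letter x) w"

fun cancel_cons :: "'a \<times> bool \<Rightarrow> ('a \<times> bool) list \<Rightarrow> ('a \<times> bool) list" where
  "cancel_cons x [] = [x]"
| "cancel_cons x (y # w) = (if y = inv_letter x then w else x # y # w)"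

definition free_group :: "'a set \<Rightarrow> ('a \<times> bool) list monoid" where
  "free_group A =
    \<lparr>carrier = {w. set w \<subseteq> A \<times> UNIV \<and> reduced_word w},
     mult = (\<lambda>u v. foldr cancel_cons u v),
     one = []\<rparr>"

definition free_gen :: "'a \<Rightarrow> ('a \<times> bool) list" where
  "free_gen a = [(a, True)]"

text \<open>The homomorphism extending a map on the generators; see \<open>free_lift_hom\<close> and
  \<open>free_lift_gen\<close> below.\<close>

definition free_lift :: "('b, 'm) monoid_scheme \<Rightarrow> ('a \<Rightarrow> 'b) \<Rightarrow> ('a \<times> bool) list \<Rightarrow> 'b" where
  "free_lift H f w =
    foldr (\<lambda>x h. (if snd x then f (fst x) else inv\<^bsub>H\<^esub> (f (fst x))) \<otimes>\<^bsub>H\<^esub> h) w \<one>\<^bsub>H\<^esub>"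


section \<open>Configurations and moduli spaces\<close>

text \<open>Indices run cyclically through \<open>{1..n}\<close>. The \<open>i\<close>-th edge joins \<open>P i\<close> to
  \<open>P (nxt n i)\<close> and has length \<open>l i\<close>.\<close>

definition nxt :: "nat \<Rightarrow> nat \<Rightarrow> nat" where
  "nxt n i = (if i = n then 1 else i + 1)"

definition prv :: "nat \<Rightarrow> nat \<Rightarrow> nat" where
  "prv n i = (if i = 1 then n else i - 1)"

definition config :: "nat \<Rightarrow> (nat \<Rightarrow> real) \<Rightarrow> (nat \<Rightarrow> real ^ 'd) set" where
  "config n l = {P \<in> {1..n} \<rightarrow>\<^sub>E UNIV. \<forall>i\<in>{1..n}. dist (P i) (P (nxt n i)) = l i}"

definition or_pres_isometry :: "(real ^ 'd \<Rightarrow> real ^ 'd) \<Rightarrow> bool" where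
  "or_pres_isometry g \<longleftrightarrow> (\<exists>Q b. rotation_matrix Q \<and> g = (\<lambda>x. Q *v x + b))"

definition congr :: "nat \<Rightarrow> ((nat \<Rightarrow> real ^ 'd) \<times> (nat \<Rightarrow> real ^ 'd)) set" where
  "congr n = {(P, Q). P \<in> {1..n} \<rightarrow>\<^sub>E UNIV \<and>
     (\<exists>g. or_pres_isometry g \<and> Q = (\<lambda>i\<in>{1..n}. g (P i)))}"

definition moduli :: "nat \<Rightarrow> (nat \<Rightarrow> real) \<Rightarrow> (nat \<Rightarrow> real ^ 'd) set set" where
  "moduli n l = config n l // congr n"

definition cls :: "nat \<Rightarrow> (nat \<Rightarrow> real ^ 'd) \<Rightarrow> (nat \<Rightarrow> real ^ 'd) set" where
  "cls n P = congr n `` {P}"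

definition on_cls :: "('a \<Rightarrow> real) \<Rightarrow> 'a set \<Rightarrow> real" where
  "on_cls f X = the_elem (f ` X)"

definition signed_area :: "nat \<Rightarrow> (nat \<Rightarrow> real ^ 2) \<Rightarrow> real" where
  "signed_area n P =
    (\<Sum>i = 1..n. P i $ 1 * P (nxt n i) $ 2 - P (nxt n i) $ 1 * P i $ 2) / 2"

definition vector_area :: "nat \<Rightarrow> (nat \<Rightarrow> real ^ 3) \<Rightarrow> real ^ 3" where
  "vector_area n P = (1 / 2) *\<^sub>R (\<Sum>i = 1..n. cross3 (P i) (P (nxt n i)))"

definition area_M2 :: "nat \<Rightarrow> (nat \<Rightarrow> real ^ 2) set \<Rightarrow> real" where
  "area_M2 n = on_cls (signed_area n)"

definition area_M3 :: "nat \<Rightarrow> (nat \<Rightarrow> real ^ 3) set \<Rightarrow> real" where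
  "area_M3 n = on_cls (\<lambda>P. norm (vector_area n P))"


section \<open>Critical points\<close>

text \<open>
  Near a non-collinear configuration, \<^term>\<open>config n l\<close> is a submanifold of the space of
  \<open>n\<close>-tuples of points, the isometry group acts on it freely, and the smooth structure of the
  moduli space is the one that makes the projection \<^term>\<open>cls n\<close> a submersion. The tangent
  vectors of the moduli space at \<open>X\<close> are therefore the velocities of the curves
  \<^term>\<open>\<lambda>t::real. cls n (\<gamma> t)\<close> with \<open>\<gamma>\<close> running in \<^term>\<open>config n l\<close>, and \<open>X\<close> is critical
  for \<open>F\<close> if the derivative of \<open>F\<close> along each of them is zero. Demanding more differentiability
  of \<open>\<gamma>\<close> would give the same tangent vectors.
\<close>

definition critical_point ::
    "nat \<Rightarrow> (nat \<Rightarrow> real) \<Rightarrow> ((nat \<Rightarrow> real ^ 'd) set \<Rightarrow> real) \<Rightarrow> (nat \<Rightarrow> real ^ 'd) set \<Rightarrow> bool" where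
  "critical_point n l F X \<longleftrightarrow>
     X \<in> moduli n l \<and> (\<forall>P\<in>X. \<not> collinear (P ` {1..n})) \<and>
     (\<forall>\<gamma>. (\<forall>t. \<gamma> t \<in> config n l) \<and> cls n (\<gamma> 0) = X \<and>
           (\<forall>i\<in>{1..n}. (\<lambda>t. \<gamma> t i) differentiable (at 0)) \<longrightarrow>
        ((\<lambda>t. F (cls n (\<gamma> t))) has_real_derivative 0) (at 0))"


section \<open>The swap action\<close>

definition bisector_reflection :: "'a::real_inner \<Rightarrow> 'a \<Rightarrow> 'a \<Rightarrow> 'a" where
  "bisector_reflection a b x =
     x - (2 * ((x - midpoint a b) \<bullet> (b - a)) / ((b - a) \<bullet> (b - a))) *\<^sub>R (b - a)"

definition swap :: "nat \<Rightarrow> nat \<Rightarrow> (nat \<Rightarrow> real ^ 'd) \<Rightarrow> (nat \<Rightarrow> real ^ 'd)" where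
  "swap n i P = P(i := bisector_reflection (P (prv n i)) (P (nxt n i)) (P i))"

definition swap_perm :: "nat \<Rightarrow> nat \<Rightarrow> nat \<Rightarrow> nat" where
  "swap_perm n i = Transposition.transpose (prv n i) i"

definition permuted :: "(nat \<Rightarrow> nat) \<Rightarrow> (nat \<Rightarrow> real) \<Rightarrow> nat \<Rightarrow> real" where
  "permuted \<sigma> l = (\<lambda>j. l (Hilbert_Choice.inv \<sigma> j))"

text \<open>The disjoint union of the moduli spaces of all permutations of \<open>l\<close>; the summand with
  index \<^term>\<open>id\<close> is the moduli space of \<open>l\<close> itself.\<close>

definition moduli_union :: "nat \<Rightarrow> (nat \<Rightarrow> real) \<Rightarrow> ((nat \<Rightarrow> nat) \<times> (nat \<Rightarrow> real ^ 'd) set) set" where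
  "moduli_union n l = (SIGMA \<sigma> : carrier (sym_group n). moduli n (permuted \<sigma> l))"

definition swap_map ::
    "nat \<Rightarrow> (nat \<Rightarrow> real) \<Rightarrow> nat \<Rightarrow>
     (nat \<Rightarrow> nat) \<times> (nat \<Rightarrow> real ^ 'd) set \<Rightarrow> (nat \<Rightarrow> nat) \<times> (nat \<Rightarrow> real ^ 'd) set" where
  "swap_map n l i = (\<lambda>(\<sigma>, X)\<in>moduli_union n l. (swap_perm n i \<circ> \<sigma>, swap n i ` X))"

definition swap_action ::
    "nat \<Rightarrow> (nat \<Rightarrow> real) \<Rightarrow> (nat \<times> bool) list \<Rightarrow>
     (nat \<Rightarrow> nat) \<times> (nat \<Rightarrow> real ^ 'd) set \<Rightarrow> (nat \<Rightarrow> nat) \<times> (nat \<Rightarrow> real ^ 'd) set" where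
  "swap_action n l = free_lift (BijGroup (moduli_union n l)) (swap_map n l)"

definition swap_proj :: "nat \<Rightarrow> (nat \<times> bool) list \<Rightarrow> (nat \<Rightarrow> nat)" where
  "swap_proj n = free_lift (sym_group n) (swap_perm n)"

definition pure_swaps :: "nat \<Rightarrow> (nat \<times> bool) list set" where
  "pure_swaps n = kernel (free_group {1..n}) (sym_group n) (swap_proj n)"


section \<open>Well-definedness\<close>

subsection \<open>The free group and its universal property\<close>

lemma inv_letter_inv_letter [simp]: "inv_letter (inv_letter x) = x"
  by (simp add: inv_letter_def)

lemma reduced_word_cancel_cons: "reduced_word w \<Longrightarrow> reduced_word (cancel_cons x w)"
  by (cases w) (auto simp: reduced_word_def successively_Cons)

lemma cancel_cons_inv:
  assumes "reduced_word w"
  shows "cancel_cons (inv_letter x) (cancel_cons x w) = w"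
proof (cases w)
  case (Cons y v)
  then show ?thesis using assms
    by (cases v) (auto simp: reduced_word_def)
qed auto

lemma reduced_word_foldr: "reduced_word v \<Longrightarrow> reduced_word (foldr cancel_cons u v)"
  by (induction u) (auto intro: reduced_word_cancel_cons)

lemma foldr_cancel_cons:
  assumes "reduced_word w"
  shows "foldr cancel_cons (cancel_cons x u) w = cancel_cons x (foldr cancel_cons u w)"
proof (cases u)
  case (Cons y v)
  then show ?thesis
    using cancel_cons_inv[OF reduced_word_foldr[OF assms], of "inv_letter x" v] by auto
qed auto

lemma foldr_cancel_assoc:
  assumes "reduced_word w"
  shows "foldr cancel_cons (foldr cancel_cons u v) w = foldr cancel_cons u (foldr cancel_cons v w)"
  by (induction u) (auto simp: foldr_cancel_cons[OF assms])

lemma foldr_cancel_Nil: "reduced_word u \<Longrightarrow> foldr cancel_cons u [] = u"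
proof (induction u)
  case (Cons x u)
  then show ?case by (cases u) (auto simp: reduced_word_def)
qed auto

lemma set_cancel_cons: "set (cancel_cons x w) \<subseteq> insert x (set w)"
  by (cases w) auto

lemma set_foldr_cancel: "set (foldr cancel_cons u v) \<subseteq> set u \<union> set v"
proof (induction u)
  case (Cons x u)
  then show ?case using set_cancel_cons[of x "foldr cancel_cons u v"] by auto
qed auto

lemma foldr_cancel_inverse:
  "reduced_word u \<Longrightarrow> foldr cancel_cons (rev (map inv_letter u)) u = []"
proof (induction u)
  case (Cons x u)
  then have "reduced_word u" by (auto simp: reduced_word_def successively_Cons)
  then show ?case using Cons by simp
qed auto

lemma reduced_word_inverse: "reduced_word u \<Longrightarrow> reduced_word (rev (map inv_letter u))"
  by (auto simp: reduced_word_def successively_map inv_letter_def prod_eq_iff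
           elim!: successively_mono)

lemma free_group_is_group: "group (free_group A)"
proof (rule groupI)
  fix x assume "x \<in> carrier (free_group A)"
  then have x: "set x \<subseteq> A \<times> UNIV" "reduced_word x" by (auto simp: free_group_def)
  show "\<one>\<^bsub>free_group A\<^esub> \<otimes>\<^bsub>free_group A\<^esub> x = x" by (simp add: free_group_def)
  show "\<exists>y\<in>carrier (free_group A). y \<otimes>\<^bsub>free_group A\<^esub> x = \<one>\<^bsub>free_group A\<^esub>"
    using x reduced_word_inverse[of x] foldr_cancel_inverse[of x]
    by (intro bexI[of _ "rev (map inv_letter x)"])
       (auto simp: free_group_def inv_letter_def)
next
  fix x y assume "x \<in> carrier (free_group A)" "y \<in> carrier (free_group A)"
  then show "x \<otimes>\<^bsub>free_group A\<^esub> y \<in> carrier (free_group A)"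
    using set_foldr_cancel[of x y] by (auto simp: free_group_def reduced_word_foldr)
qed (auto simp: free_group_def reduced_word_def foldr_cancel_assoc)

context
  fixes H :: "('b, 'm) monoid_scheme" and A :: "'a set" and f :: "'a \<Rightarrow> 'b"
  assumes H: "group H" and f: "\<And>a. a \<in> A \<Longrightarrow> f a \<in> carrier H"
begin

interpretation H: group H by (rule H)

lemma free_lift_closed: "set w \<subseteq> A \<times> UNIV \<Longrightarrow> free_lift H f w \<in> carrier H"
  by (induction w) (auto simp: free_lift_def f)

lemma free_lift_cancel_cons:
  assumes "set (x # w) \<subseteq> A \<times> UNIV"
  shows "free_lift H f (cancel_cons x w) = free_lift H f [x] \<otimes>\<^bsub>H\<^esub> free_lift H f w"
proof (cases w)
  case Nil
  then show ?thesis using free_lift_closed[of "[x]"] assms by (simp add: free_lift_def)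
next
  case (Cons y v)
  have v: "free_lift H f v \<in> carrier H" using assms Cons by (intro free_lift_closed) auto
  obtain a b where x: "x = (a, b)" and a: "a \<in> A" using assms by (cases x) auto
  show ?thesis
  proof (cases "y = inv_letter x")
    case True
    with v f[OF a] show ?thesis
      by (cases b) (simp_all add: Cons x inv_letter_def free_lift_def flip: H.m_assoc)
  next
    case False
    have "free_lift H f w \<in> carrier H" using assms by (intro free_lift_closed) auto
    with False f[OF a] show ?thesis
      by (cases b) (simp_all add: Cons x free_lift_def)
  qed
qed

lemma free_lift_hom: "free_lift H f \<in> hom (free_group A) H"
proof (rule homI)
  fix u assume "u \<in> carrier (free_group A)"
  then show "free_lift H f u \<in> carrier H" by (auto simp: free_group_def intro!: free_lift_closed)
next
  fix u v assume "u \<in> carrier (free_group A)" "v \<in> carrier (free_group A)"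
  then have "set u \<subseteq> A \<times> UNIV" "set v \<subseteq> A \<times> UNIV" by (auto simp: free_group_def)
  then have "free_lift H f (foldr cancel_cons u v) = free_lift H f u \<otimes>\<^bsub>H\<^esub> free_lift H f v"
  proof (induction u)
    case Nil
    then show ?case using free_lift_closed[of v] by (simp add: free_lift_def)
  next
    case (Cons x u)
    have "free_lift H f (foldr cancel_cons (x # u) v)
        = free_lift H f [x] \<otimes>\<^bsub>H\<^esub> free_lift H f (foldr cancel_cons u v)"
      using free_lift_cancel_cons[of x "foldr cancel_cons u v"] set_foldr_cancel[of u v] Cons.prems
      by auto
    also have "\<dots> = free_lift H f [x] \<otimes>\<^bsub>H\<^esub> (free_lift H f u \<otimes>\<^bsub>H\<^esub> free_lift H f v)"
      using Cons by simp
    also have "\<dots> = free_lift H f [x] \<otimes>\<^bsub>H\<^esub> free_lift H f u \<otimes>\<^bsub>H\<^esub> free_lift H f v"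
      using Cons.prems by (intro H.m_assoc[symmetric] free_lift_closed) auto
    also have "free_lift H f [x] \<otimes>\<^bsub>H\<^esub> free_lift H f u = free_lift H f (x # u)"
      using free_lift_closed[of "[x]"] f Cons.prems by (cases x) (auto simp: free_lift_def)
    finally show ?case .
  qed
  then show "free_lift H f (u \<otimes>\<^bsub>free_group A\<^esub> v) = free_lift H f u \<otimes>\<^bsub>H\<^esub> free_lift H f v"
    by (simp add: free_group_def)
qed

lemma free_lift_gen: "a \<in> A \<Longrightarrow> free_lift H f (free_gen a) = f a"
  by (simp add: free_lift_def free_gen_def f)

end


subsection \<open>The swap action\<close>

lemma
  fixes a b x :: "'a::real_inner"
  shows bisector_reflection_invol: "bisector_reflection a b (bisector_reflection a b x) = x"
    and dist_bisector_reflection_left: "dist a (bisector_reflection a b x) = dist b x"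
    and dist_bisector_reflection_right: "dist b (bisector_reflection a b x) = dist a x"
proof -
  define v y where "v = b - a" and "y = x - midpoint a b"
  define c where "c = 2 * (y \<bullet> v) / (v \<bullet> v)"
  have c: "c * (v \<bullet> v) = 2 * (y \<bullet> v)" by (cases "v = 0") (auto simp: c_def)
  have r: "bisector_reflection a b x = midpoint a b + (y - c *\<^sub>R v)"
    by (simp add: bisector_reflection_def v_def y_def c_def)
  have a: "a = midpoint a b - (1/2) *\<^sub>R v" and b: "b = midpoint a b + (1/2) *\<^sub>R v"
    by (simp_all add: midpoint_def v_def algebra_simps flip: scaleR_left_distrib)
  have x: "x = midpoint a b + y" by (simp add: y_def)
  have "(y - c *\<^sub>R v) \<bullet> v = - (y \<bullet> v)" using c by (simp add: inner_diff_left)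
  then have "2 * ((y - c *\<^sub>R v) \<bullet> v) / (v \<bullet> v) = - c" by (simp add: c_def)
  then have "bisector_reflection a b (midpoint a b + (y - c *\<^sub>R v)) = midpoint a b + y"
    by (simp add: bisector_reflection_def flip: v_def)
  then show "bisector_reflection a b (bisector_reflection a b x) = x" using r x by simp
  have n: "norm (s *\<^sub>R v + (y - c *\<^sub>R v)) = norm (y - s *\<^sub>R v)" for s
  proof -
    have "(s *\<^sub>R v + (y - c *\<^sub>R v)) \<bullet> (s *\<^sub>R v + (y - c *\<^sub>R v)) - (y - s *\<^sub>R v) \<bullet> (y - s *\<^sub>R v)
        = (c - 2 * s) * (c * (v \<bullet> v) - 2 * (y \<bullet> v))"
      by (simp add: inner_simps inner_commute algebra_simps)
    then show ?thesis using c by (simp add: norm_eq_sqrt_inner)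
  qed
  have "dist a (bisector_reflection a b x) = norm ((1/2) *\<^sub>R v + (y - c *\<^sub>R v))"
    by (subst r, subst (1) a) (simp add: dist_norm norm_minus_commute algebra_simps)
  also have "\<dots> = dist b x"
    by (subst n, subst x, subst (1) b) (simp add: dist_norm norm_minus_commute)
  finally show "dist a (bisector_reflection a b x) = dist b x" .
  have "dist b (bisector_reflection a b x) = norm ((- 1/2) *\<^sub>R v + (y - c *\<^sub>R v))"
    by (subst r, subst (1) b) (simp add: dist_norm norm_minus_commute algebra_simps)
  also have "\<dots> = dist a x"
    by (subst n, subst x, subst (1) a) (simp add: dist_norm norm_minus_commute)
  finally show "dist b (bisector_reflection a b x) = dist a x" .
qed

lemma bisector_reflection_isometry:
  assumes "or_pres_isometry g"
  shows "bisector_reflection (g a) (g b) (g x) = g (bisector_reflection a b x)"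
proof -
  obtain Q t where Q: "rotation_matrix Q" and g: "g = (\<lambda>x. Q *v x + t)"
    using assms by (auto simp: or_pres_isometry_def)
  have inner: "(Q *v u) \<bullet> (Q *v v) = u \<bullet> v" for u v
    using Q by (metis orthogonal_matrix rotation_matrix_def matrix_vector_mul_assoc
        dot_lmul_matrix matrix_vector_mul_lid transpose_matrix_vector vector_transpose_matrix)
  have diff: "g u - g v = Q *v (u - v)" for u v
    by (simp add: g matrix_vector_mult_diff_distrib)
  have mid: "midpoint (g a) (g b) = g (midpoint a b)"
    by (simp add: g midpoint_def matrix_vector_mult_scaleR matrix_vector_right_distrib
        vec_eq_iff)
  show ?thesis
    unfolding bisector_reflection_def mid diff inner
    by (simp add: g matrix_vector_mult_diff_distrib matrix_vector_mult_scaleR)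
qed

context
  fixes n i :: nat
  assumes n: "n \<ge> 3" and i: "i \<in> {1..n}"
begin

lemma cyclic_indices:
  "prv n i \<in> {1..n}" "nxt n i \<in> {1..n}" "prv n i \<noteq> i" "nxt n i \<noteq> i" "prv n i \<noteq> nxt n i"
  "nxt n (prv n i) = i"
  using n i by (auto simp: prv_def nxt_def split: if_splits)

lemma swap_perm_permutes: "swap_perm n i permutes {1..n}"
  using cyclic_indices i by (simp add: swap_perm_def permutes_swap_id)

lemma swap_swap: "swap n i (swap n i P) = P"
  using cyclic_indices by (simp add: swap_def bisector_reflection_invol fun_upd_idem_iff)

lemma swap_config:
  assumes "P \<in> config n l"
  shows "swap n i P \<in> config n (permuted (swap_perm n i) l)"
proof -
  have P: "P \<in> {1..n} \<rightarrow>\<^sub>E UNIV" and d: "\<And>j. j \<in> {1..n} \<Longrightarrow> dist (P j) (P (nxt n j)) = l j"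
    using assms by (auto simp: config_def)
  have "dist (swap n i P j) (swap n i P (nxt n j)) = permuted (swap_perm n i) l j"
    if j: "j \<in> {1..n}" for j
  proof -
    consider "j = i" | "j = prv n i" | "j \<noteq> i" "nxt n j \<noteq> i" "j \<noteq> prv n i"
      using i j by (force simp: nxt_def prv_def split: if_splits)
    then show ?thesis
      using cyclic_indices i d[OF i] d[of "prv n i"] d[OF j]
      by cases (simp_all add: swap_def permuted_def swap_perm_def dist_bisector_reflection_left
          dist_bisector_reflection_right dist_commute)
  qed
  moreover have "swap n i P \<in> {1..n} \<rightarrow>\<^sub>E UNIV" using P i by (auto simp: swap_def)
  ultimately show ?thesis by (simp add: config_def)
qed

lemma swap_isometry:
  assumes "or_pres_isometry g"
  shows "swap n i (\<lambda>j\<in>{1..n}. g (P j)) = (\<lambda>j\<in>{1..n}. g (swap n i P j))"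
  using cyclic_indices i assms by (auto simp: swap_def bisector_reflection_isometry restrict_def)

lemma swap_cls:
  assumes "P \<in> config n l"
  shows "swap n i ` cls n P = cls n (swap n i P)"
proof -
  have cls: "cls n R = (\<lambda>g. \<lambda>j\<in>{1..n}. g (R j)) ` Collect or_pres_isometry"
    if "R \<in> {1..n} \<rightarrow>\<^sub>E UNIV" for R :: "nat \<Rightarrow> real ^ 'd"
    using that by (auto simp: cls_def congr_def)
  have P: "P \<in> {1..n} \<rightarrow>\<^sub>E UNIV" and swap_P: "swap n i P \<in> {1..n} \<rightarrow>\<^sub>E UNIV"
    using assms swap_config[OF assms] by (auto simp: config_def)
  then show ?thesis
    unfolding cls[OF P] cls[OF swap_P] image_image
    by (intro image_cong refl swap_isometry) simp
qed

lemma swap_moduli: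
  assumes "X \<in> moduli n l"
  shows "swap n i ` X \<in> moduli n (permuted (swap_perm n i) l)"
proof -
  obtain P where P: "P \<in> config n l" "X = cls n P"
    using assms by (auto simp: moduli_def cls_def elim: quotientE)
  then show ?thesis
    using swap_cls[OF P(1)] swap_config[OF P(1)]
    by (auto simp: moduli_def cls_def intro: quotientI)
qed

lemma swap_map_Bij:
  "swap_map n l i \<in> Bij (moduli_union n l :: ((nat \<Rightarrow> nat) \<times> (nat \<Rightarrow> real ^ 'd) set) set)"
proof -
  let ?E = "moduli_union n l :: ((nat \<Rightarrow> nat) \<times> (nat \<Rightarrow> real ^ 'd) set) set"
  have perm: "permuted (swap_perm n i \<circ> \<sigma>) l = permuted (swap_perm n i) (permuted \<sigma> l)"
    if "\<sigma> permutes {1..n}" for \<sigma>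
    using that swap_perm_permutes
    by (simp add: permuted_def fun_eq_iff o_inv_distrib permutes_bij)
  have maps: "swap_map n l i x \<in> ?E" if "x \<in> ?E" for x
    using that perm swap_perm_permutes swap_moduli
    by (auto simp: swap_map_def moduli_union_def sym_group_carrier permutes_compose)
  have invol: "swap_map n l i (swap_map n l i x) = x" if "x \<in> ?E" for x
  proof -
    obtain \<sigma> X where x: "x = (\<sigma>, X)" by force
    have "swap_perm n i \<circ> (swap_perm n i \<circ> \<sigma>) = \<sigma>"
      by (simp add: swap_perm_def fun_eq_iff)
    moreover have "(swap_perm n i \<circ> \<sigma>, swap n i ` X) \<in> ?E"
      using maps[OF that] that by (simp add: swap_map_def x)
    ultimately show ?thesis
      using that by (simp add: swap_map_def x image_image swap_swap)
  qed
  have "bij_betw (swap_map n l i) ?E ?E"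
    by (rule bij_betw_byWitness[where f' = "swap_map n l i"]) (auto simp: maps invol)
  then show ?thesis by (auto simp: Bij_def swap_map_def)
qed

end

theorem swap_action_group_action:
  assumes "n \<ge> 3"
  shows "group_action (free_group {1..n})
           (moduli_union n l :: ((nat \<Rightarrow> nat) \<times> (nat \<Rightarrow> real ^ 'd) set) set) (swap_action n l)"
    and "\<And>i. i \<in> {1..n} \<Longrightarrow> swap_action n l (free_gen i) =
           (swap_map n l i :: (nat \<Rightarrow> nat) \<times> (nat \<Rightarrow> real ^ 'd) set \<Rightarrow> _)"
proof -
  let ?B = "BijGroup (moduli_union n l :: ((nat \<Rightarrow> nat) \<times> (nat \<Rightarrow> real ^ 'd) set) set)"
  have B: "group ?B" by (rule group_BijGroup)
  have gen: "swap_map n l i \<in> carrier ?B" if "i \<in> {1..n}" for i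
    using swap_map_Bij[OF assms that] by (simp add: BijGroup_def)
  have "swap_action n l \<in> hom (free_group {1..n}) ?B"
    unfolding swap_action_def by (rule free_lift_hom[OF B gen])
  then show "group_action (free_group {1..n})
      (moduli_union n l :: ((nat \<Rightarrow> nat) \<times> (nat \<Rightarrow> real ^ 'd) set) set) (swap_action n l)"
    by (intro group_action.intro group_hom.intro group_hom_axioms.intro free_group_is_group B)
  show "swap_action n l (free_gen i) =
      (swap_map n l i :: (nat \<Rightarrow> nat) \<times> (nat \<Rightarrow> real ^ 'd) set \<Rightarrow> _)" if "i \<in> {1..n}" for i
    unfolding swap_action_def using that by (intro free_lift_gen[OF B gen])
qed

theorem swap_proj_hom:
  assumes "n \<ge> 3"
  shows "swap_proj n \<in> hom (free_group {1..n}) (sym_group n)"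
    and "\<And>i. i \<in> {1..n} \<Longrightarrow> swap_proj n (free_gen i) = swap_perm n i"
proof -
  have gen: "swap_perm n i \<in> carrier (sym_group n)" if "i \<in> {1..n}" for i
    using swap_perm_permutes[OF assms that] by (simp add: sym_group_carrier)
  show "swap_proj n \<in> hom (free_group {1..n}) (sym_group n)"
    unfolding swap_proj_def by (rule free_lift_hom[OF sym_group_is_group gen])
  show "swap_proj n (free_gen i) = swap_perm n i" if "i \<in> {1..n}" for i
    unfolding swap_proj_def using that by (intro free_lift_gen[OF sym_group_is_group gen])
qed


subsection \<open>The area functions on the moduli spaces\<close>

lemma sum_nxt:
  fixes h :: "nat \<Rightarrow> 'a::comm_monoid_add"
  assumes "n \<ge> 1"
  shows "(\<Sum>i = 1..n. h (nxt n i)) = (\<Sum>i = 1..n. h i)"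
  using assms
  by (intro sum.reindex_bij_witness[where i = "prv n" and j = "nxt n"])
     (auto simp: nxt_def prv_def)

lemma or_pres_isometry_id: "or_pres_isometry (\<lambda>x. x)"
  unfolding or_pres_isometry_def
  by (rule exI[of _ "mat 1"], rule exI[of _ 0])
     (simp add: rotation_matrix_def orthogonal_matrix_id)

lemma on_cls_cls:
  assumes P: "P \<in> config n l"
    and inv: "\<And>g. or_pres_isometry g \<Longrightarrow> f (\<lambda>i\<in>{1..n}. g (P i)) = f P"
  shows "on_cls f (cls n P) = f P"
proof -
  have "(\<lambda>i\<in>{1..n}. P i) = P" using P by (auto simp: config_def dest: PiE_restrict)
  then have "P \<in> cls n P"
    using P or_pres_isometry_id by (force simp: cls_def congr_def config_def)
  then have "f ` cls n P = {f P}" using inv by (auto simp: cls_def congr_def)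
  then show ?thesis by (simp add: on_cls_def)
qed

lemma nxt_in: "i \<in> {1..n} \<Longrightarrow> nxt n i \<in> {1..n}"
  by (auto simp: nxt_def)

lemma area_M2_cls:
  assumes n: "n \<ge> 1" and P: "P \<in> config n l"
  shows "area_M2 n (cls n P) = signed_area n P"
  unfolding area_M2_def
proof (rule on_cls_cls[OF P])
  fix g :: "real ^ 2 \<Rightarrow> real ^ 2" assume "or_pres_isometry g"
  then obtain Q b where Q: "rotation_matrix Q" and g: "g = (\<lambda>x. Q *v x + b)"
    by (auto simp: or_pres_isometry_def)
  define D where "D x y = x $ 1 * y $ 2 - y $ 1 * x $ 2" for x y :: "real ^ 2"
  have det: "Q $ 1 $ 1 * Q $ 2 $ 2 - Q $ 1 $ 2 * Q $ 2 $ 1 = 1"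
    using Q by (simp add: rotation_matrix_def det_2)
  have DQ: "D (Q *v x) (Q *v y) = D x y" for x y
  proof -
    have "D (Q *v x) (Q *v y) = (Q $ 1 $ 1 * Q $ 2 $ 2 - Q $ 1 $ 2 * Q $ 2 $ 1) * D x y"
      by (simp add: D_def matrix_vector_mult_def sum_2 algebra_simps)
    then show ?thesis using det by simp
  qed
  have Dg: "D (g x) (g y) = D x y + (D (Q *v x) b - D (Q *v y) b)" for x y
    using DQ[of x y] by (simp add: g D_def algebra_simps)
  have "(\<Sum>i = 1..n. D (g (P i)) (g (P (nxt n i))))
      = (\<Sum>i = 1..n. D (P i) (P (nxt n i)) + (D (Q *v P i) b - D (Q *v P (nxt n i)) b))"
    by (simp only: Dg)
  also have "\<dots> = (\<Sum>i = 1..n. D (P i) (P (nxt n i)))"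
    using sum_nxt[OF n, of "\<lambda>i. D (Q *v P i) b"] by (simp add: sum.distrib sum_subtractf)
  finally show "signed_area n (\<lambda>i\<in>{1..n}. g (P i)) = signed_area n P"
    using nxt_in[of _ n] by (simp add: signed_area_def D_def)
qed

lemma area_M3_cls:
  assumes n: "n \<ge> 1" and P: "P \<in> config n l"
  shows "area_M3 n (cls n P) = norm (vector_area n P)"
  unfolding area_M3_def
proof (rule on_cls_cls[OF P])
  fix g :: "real ^ 3 \<Rightarrow> real ^ 3" assume "or_pres_isometry g"
  then obtain Q b where Q: "rotation_matrix Q" and g: "g = (\<lambda>x. Q *v x + b)"
    by (auto simp: or_pres_isometry_def)
  have skew: "cross3 b y = - cross3 y b" for y by (rule cross_skew)
  have "(\<Sum>i = 1..n. cross3 (g (P i)) (g (P (nxt n i))))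
      = (\<Sum>i = 1..n. Q *v cross3 (P i) (P (nxt n i))
          + (cross3 (Q *v P i) b - cross3 (Q *v P (nxt n i)) b))"
    by (rule sum.cong)
       (auto simp: g cross_add_left cross_add_right skew cross_rotation_matrix[OF Q, symmetric])
  also have "\<dots> = Q *v (\<Sum>i = 1..n. cross3 (P i) (P (nxt n i)))"
    using sum_nxt[OF n, of "\<lambda>i. cross3 (Q *v P i) b"]
    by (simp add: sum.distrib sum_subtractf linear_sum[OF matrix_vector_mul_linear])
  finally have "vector_area n (\<lambda>i\<in>{1..n}. g (P i)) = Q *v vector_area n P"
    using nxt_in[of _ n] by (simp add: vector_area_def matrix_vector_mult_scaleR)
  moreover have "norm (Q *v x) = norm x" for x
    using Q by (intro orthogonal_transformation_norm)
       (simp add: rotation_matrix_def orthogonal_transformation_matrix)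
  ultimately show "norm (vector_area n (\<lambda>i\<in>{1..n}. g (P i))) = norm (vector_area n P)" by simp
qed

end

theory Submission
  imports Defs
begin

text \<open>
  Let \<open>J\<close> be the quarter turn of the plane or, in space, the cross product with the unit vector \<open>u\<close>
  in the direction of the vector area; near the given configuration the area to first order is
  \<open>\<Sum>i. J p\<^sub>i \<bullet> p\<^sub>i\<^sub>+\<^sub>1 / 2\<close>. Its Lagrange condition reads
  \<open>J (p\<^sub>i + p\<^sub>i\<^sub>+\<^sub>1) = c + \<mu>\<^sub>i (p\<^sub>i\<^sub>+\<^sub>1 - p\<^sub>i)\<close>, and after a translation \<open>J c = 0\<close>. Then all vertices lie on a
  circle, or on a cylinder with axis \<open>u\<close>, and \<open>p\<^sub>i\<^sub>+\<^sub>1\<close> arises from \<open>p\<^sub>i\<close> by a rotation, or a screw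
  motion, \<open>T\<^sub>i\<close> about the common axis. The \<open>T\<^sub>i\<close> commute, and it turns out that a swap only transposes
  two of them. A pure word of swaps thus restores the sequence of the \<open>T\<^sub>i\<close>, which determines the
  configuration up to a motion about the axis.
\<close>

section \<open>Lagrange multipliers\<close>

text \<open>Strict Cauchy-Schwarz. The Gram determinant is the denominator in
  \<open>orthogonal_split\<close> and gives the triangle in \<open>triangle_curve\<close> a positive
  height.\<close>

lemma gram_pos:
  fixes a b :: "'a::euclidean_space"
  assumes "\<not> collinear {0, a, b}"
  shows "(a \<bullet> a) * (b \<bullet> b) - (a \<bullet> b)\<^sup>2 > 0"
proof -
  have "\<bar>a \<bullet> b\<bar> < norm a * norm b"
    using assms norm_cauchy_schwarz_equal[of a b] Cauchy_Schwarz_ineq2[of a b] by fastforce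
  then have "\<bar>a \<bullet> b\<bar>\<^sup>2 < (norm a * norm b)\<^sup>2"
    by (intro power_strict_mono) auto
  then show ?thesis by (simp add: power_mult_distrib power2_norm_eq_inner)
qed

text \<open>The component of \<open>x\<close> orthogonal to \<open>a\<close> and \<open>b\<close> is
  an admissible \<open>z\<close>; being orthogonal to \<open>x\<close> as well, it vanishes.\<close>

lemma in_span_pair:
  fixes a b x :: "'a::euclidean_space"
  assumes "\<And>z. z \<bullet> a = 0 \<Longrightarrow> z \<bullet> b = 0 \<Longrightarrow> x \<bullet> z = 0"
  shows "\<exists>\<alpha> \<beta>. x = \<alpha> *\<^sub>R a + \<beta> *\<^sub>R b"
proof -
  obtain y z where y: "y \<in> span {a, b}" and z: "\<And>w. w \<in> span {a, b} \<Longrightarrow> orthogonal z w"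
    and x: "x = y + z"
    using orthogonal_subspace_decomp_exists[of "{a, b}" x] by metis
  have za: "z \<bullet> a = 0" "z \<bullet> b = 0" "z \<bullet> y = 0"
    using z y by (auto simp: orthogonal_def span_base)
  have "x \<bullet> z = 0" using assms za by blast
  then have "z = 0" using za by (simp add: x inner_simps inner_commute)
  then obtain \<alpha> \<beta> where "x - \<alpha> *\<^sub>R a = \<beta> *\<^sub>R b"
    using x y by (auto simp: span_breakdown_eq)
  then have "x = \<alpha> *\<^sub>R a + \<beta> *\<^sub>R b" by (simp add: algebra_simps)
  then show ?thesis by blast
qed

text \<open>The orthogonal complements of two independent vectors together span the space.\<close>

lemma orthogonal_split:
  fixes a b x :: "'a::euclidean_space"
  assumes "\<not> collinear {0, a, b}"
  shows "\<exists>y z. x = y + z \<and> y \<bullet> a = 0 \<and> z \<bullet> b = 0"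
proof -
  define D where "D = (a \<bullet> a) * (b \<bullet> b) - (a \<bullet> b)\<^sup>2"
  define k where "k = (x \<bullet> a) / D"
  \<comment> \<open>A multiple of the part of \<open>a\<close> orthogonal to \<open>b\<close>,
    scaled so that \<open>z\<close> and \<open>x\<close> have the same inner product with
    \<open>a\<close>.\<close>
  define z where "z = k *\<^sub>R ((b \<bullet> b) *\<^sub>R a - (a \<bullet> b) *\<^sub>R b)"
  have "D \<noteq> 0" using gram_pos[OF assms] by (simp add: D_def)
  have "z \<bullet> b = 0" by (simp add: z_def inner_simps inner_commute)
  moreover have "z \<bullet> a = k * D"
    by (simp add: z_def D_def inner_simps inner_commute power2_eq_square algebra_simps)
  then have "(x - z) \<bullet> a = 0" using \<open>D \<noteq> 0\<close> by (simp add: k_def inner_simps)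
  ultimately show ?thesis by (metis diff_add_cancel)
qed

text \<open>Variations of the independent vectors \<open>e a\<close> and \<open>e b\<close> alone
  fix \<open>c\<close>; a variation of any other vector can be compensated by these two, which
  yields its multiplier.\<close>

lemma lagrange_multipliers:
  fixes e G :: "'i \<Rightarrow> 'a::euclidean_space"
  assumes I: "finite I" "a \<in> I" "b \<in> I" and ab: "\<not> collinear {0, e a, e b}"
    and crit: "\<And>v. (\<And>i. i \<in> I \<Longrightarrow> v i \<bullet> e i = 0) \<Longrightarrow> (\<Sum>i\<in>I. v i) = 0 \<Longrightarrow> (\<Sum>i\<in>I. G i \<bullet> v i) = 0"
  shows "\<exists>c \<mu>. \<forall>i\<in>I. G i = c + \<mu> i *\<^sub>R e i"
proof -
  have "a \<noteq> b" using ab by auto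
  have "(G a - G b) \<bullet> z = 0" if "z \<bullet> e a = 0" "z \<bullet> e b = 0" for z
  proof -
    \<comment> \<open>The vectors at \<open>a\<close> and \<open>b\<close> move by opposite amounts,
      all others rest.\<close>
    define v where "v i = (if i = a then z else 0) - (if i = b then z else 0)" for i
    have "(\<Sum>i\<in>I. G i \<bullet> v i) = 0"
      using that I by (intro crit) (auto simp: v_def sum_subtractf)
    moreover have "G i \<bullet> v i = (if i = a then G a \<bullet> z else 0) - (if i = b then G b \<bullet> z else 0)" for i
      by (auto simp: v_def)
    ultimately show ?thesis using I by (simp add: sum_subtractf inner_diff_left)
  qed
  then obtain \<alpha> \<beta> where "G a - G b = \<alpha> *\<^sub>R e a + \<beta> *\<^sub>R e b"
    using in_span_pair by blast
  \<comment> \<open>This choice solves the equations at \<open>a\<close> and at \<open>b\<close>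
    simultaneously.\<close>
  define c where "c = G a - \<alpha> *\<^sub>R e a"
  have Ga: "G a = c + \<alpha> *\<^sub>R e a" and Gb: "G b = c + (- \<beta>) *\<^sub>R e b"
    using \<open>G a - G b = _\<close> by (simp_all add: c_def algebra_simps)
  have "\<exists>\<mu>. G i = c + \<mu> *\<^sub>R e i" if i: "i \<in> I" for i
  proof (cases "i = a \<or> i = b")
    case True
    then show ?thesis using Ga Gb by blast
  next
    case False
    have orth: "(G i - c) \<bullet> x = 0" if x: "x \<bullet> e i = 0" for x
    proof -
      obtain y z where yz: "x = y + z" "y \<bullet> e a = 0" "z \<bullet> e b = 0"
        using orthogonal_split[OF ab] by blast
      \<comment> \<open>The vector at \<open>i\<close> moves by \<open>x\<close>; its two parts are
        taken back at \<open>a\<close> and \<open>b\<close>, each orthogonally to the vector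
        there.\<close>
      define v where
        "v j = (if j = i then x else 0) - (if j = a then y else 0) - (if j = b then z else 0)" for j
      have "(\<Sum>j\<in>I. G j \<bullet> v j) = 0"
        using I i False x yz \<open>a \<noteq> b\<close> by (intro crit) (auto simp: v_def sum_subtractf)
      moreover have "G j \<bullet> v j = (if j = i then G i \<bullet> x else 0) - (if j = a then G a \<bullet> y else 0)
          - (if j = b then G b \<bullet> z else 0)" for j
        by (auto simp: v_def inner_diff_right)
      ultimately have "G i \<bullet> x = G a \<bullet> y + G b \<bullet> z"
        using I i by (simp add: sum_subtractf)
      also have "\<dots> = c \<bullet> x" using yz by (simp add: Ga Gb inner_simps inner_commute)
      finally show ?thesis by (simp add: inner_simps)
    qed
    \<comment> \<open>Both spanning vectors are taken to be \<open>e i\<close>.\<close>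
    have "\<exists>\<mu> \<nu>. G i - c = \<mu> *\<^sub>R e i + \<nu> *\<^sub>R e i"
      by (rule in_span_pair) (rule orth)
    then obtain \<mu> \<nu> where "G i - c = \<mu> *\<^sub>R e i + \<nu> *\<^sub>R e i" by blast
    then show ?thesis by (intro exI[of _ "\<mu> + \<nu>"]) (simp add: algebra_simps)
  qed
  then show ?thesis by metis
qed

section \<open>Deformations of a linkage\<close>

text \<open>The line through \<open>e\<close> with velocity \<open>v\<close> is rescaled to constant
  norm. By orthogonality its squared norm depends on \<open>t\<close> only through the square of
  \<open>t\<close>, so the rescaling leaves the velocity at 0 unchanged.\<close>

lemma sphere_curve:
  fixes e v :: "'a::euclidean_space"
  assumes "v \<bullet> e = 0" "e \<noteq> 0"
  shows "\<exists>E :: real \<Rightarrow> 'a. E 0 = e \<and> (\<forall>t. norm (E t) = norm e) \<and> (E has_vector_derivative v) (at 0)"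
proof -
  define q where "q = (v \<bullet> v) / (e \<bullet> e)"
  have q: "q \<ge> 0" "v \<bullet> v = q * (e \<bullet> e)" using assms by (auto simp: q_def)
  have pos: "1 + t\<^sup>2 * q > 0" for t :: real
    using q by (simp add: add_pos_nonneg)
  define E where "E = (\<lambda>t. (1 / sqrt (1 + t\<^sup>2 * q)) *\<^sub>R (e + t *\<^sub>R v))"
  have "norm (E t) = norm e" for t
  proof -
    have "(norm (e + t *\<^sub>R v))\<^sup>2 = (1 + t\<^sup>2 * q) * (e \<bullet> e)"
      unfolding power2_norm_eq_inner
      using assms(1) by (simp add: inner_simps inner_commute q power2_eq_square algebra_simps)
    then have "norm (e + t *\<^sub>R v) = sqrt (1 + t\<^sup>2 * q) * norm e"
      by (metis norm_eq_sqrt_inner norm_ge_zero real_sqrt_mult real_sqrt_unique)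
    then show ?thesis using pos[of t] by (simp add: E_def)
  qed
  moreover have "(E has_vector_derivative v) (at 0)"
    unfolding E_def by (auto intro!: derivative_eq_intros)
  moreover have "E 0 = e" by (simp add: E_def)
  ultimately show ?thesis by blast
qed

text \<open>Two edges have to bridge the moving chord \<open>s\<close>. The triangle is built from
  the foot and the height of its altitude; this works as long as the triangle inequality holds,
  hence the restriction to \<open>t\<close> near 0.\<close>

lemma triangle_curve:
  fixes a b va vb :: "'a::euclidean_space" and s :: "real \<Rightarrow> 'a"
  assumes ab: "\<not> collinear {0, a, b}" and va: "va \<bullet> a = 0" and vb: "vb \<bullet> b = 0"
    and s0: "s 0 = a + b" and s': "(s has_vector_derivative va + vb) (at 0)"
  shows "\<exists>\<alpha>. \<alpha> 0 = a \<and> (\<alpha> has_vector_derivative va) (at 0) \<and>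
           (\<forall>\<^sub>F t in at 0. norm (\<alpha> t) = norm a \<and> norm (s t - \<alpha> t) = norm b)"
proof -
  \<comment> \<open>\<open>u\<close> has the wanted velocity but not the wanted length; it only
    selects the plane in which the triangle is erected over \<open>s t\<close>.\<close>
  define u where "u = (\<lambda>t. a + t *\<^sub>R va)"
  define f where "f = (\<lambda>t. (u t \<bullet> s t) / (s t \<bullet> s t))"
  \<comment> \<open>Law of cosines: \<open>c t *\<^sub>R s t\<close> is the foot of the
    altitude.\<close>
  define c where "c = (\<lambda>t. (s t \<bullet> s t + a \<bullet> a - b \<bullet> b) / (2 * (s t \<bullet> s t)))"
  define w where "w = (\<lambda>t. u t - f t *\<^sub>R s t)"
  \<comment> \<open>By Pythagoras \<open>m t\<close> is the squared height, and \<open>g t\<close>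
    stretches \<open>w t\<close> to that height.\<close>
  define m where "m = (\<lambda>t. a \<bullet> a - (c t)\<^sup>2 * (s t \<bullet> s t))"
  define g where "g = (\<lambda>t. sqrt (m t / (w t \<bullet> w t)))"
  define \<alpha> where "\<alpha> = (\<lambda>t. c t *\<^sub>R s t + g t *\<^sub>R w t)"
  note inner_deriv = bounded_bilinear.has_vector_derivative[OF bounded_bilinear_inner,
      folded has_real_derivative_iff_has_vector_derivative]
  note scale_deriv = bounded_bilinear.has_vector_derivative[OF bounded_bilinear_scaleR]
  have gram: "(a \<bullet> a) * (b \<bullet> b) - (a \<bullet> b)\<^sup>2 > 0" by (rule gram_pos[OF ab])
  have s_nz: "s 0 \<noteq> 0"
  proof
    assume "s 0 = 0"
    then have "b = - a" using s0 by (simp add: eq_neg_iff_add_eq_0 add.commute)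
    then show False using gram by (simp add: power2_eq_square)
  qed
  have ss_nz: "(a + b) \<bullet> (a + b) > 0" using s_nz s0 by simp
  have "(a + b) \<bullet> (a + b) + a \<bullet> a - b \<bullet> b = 2 * (a \<bullet> (a + b))"
    by (simp add: inner_simps inner_commute)
  then have f0: "f 0 = c 0" by (simp add: f_def c_def u_def s0)
  have w0: "w 0 = a - c 0 *\<^sub>R (a + b)" by (simp add: w_def u_def f0 s0)
  have c0: "c 0 * ((a + b) \<bullet> (a + b)) = a \<bullet> (a + b)"
    using ss_nz f0 by (simp add: f_def u_def s0 flip: f0)
  have ww: "w 0 \<bullet> w 0 = a \<bullet> a - (c 0)\<^sup>2 * ((a + b) \<bullet> (a + b))"
  proof -
    have "w 0 \<bullet> w 0 = a \<bullet> a - 2 * c 0 * (a \<bullet> (a + b)) + (c 0)\<^sup>2 * ((a + b) \<bullet> (a + b))"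
      unfolding w0 by (simp add: inner_simps inner_commute power2_eq_square algebra_simps)
    then show ?thesis by (simp add: power2_eq_square flip: c0)
  qed
  \<comment> \<open>Squared height times squared base is the Gram determinant, so \<open>w 0\<close>
    is nonzero.\<close>
  have "w 0 \<bullet> w 0 * ((a + b) \<bullet> (a + b)) = (a \<bullet> a) * (b \<bullet> b) - (a \<bullet> b)\<^sup>2"
  proof -
    have "w 0 \<bullet> w 0 * ((a + b) \<bullet> (a + b))
        = a \<bullet> a * ((a + b) \<bullet> (a + b)) - (c 0 * ((a + b) \<bullet> (a + b)))\<^sup>2"
      unfolding ww by (simp add: power2_eq_square algebra_simps)
    also have "\<dots> = (a \<bullet> a) * (b \<bullet> b) - (a \<bullet> b)\<^sup>2"
      unfolding c0 by (simp add: inner_simps inner_commute power2_eq_square algebra_simps)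
    finally show ?thesis .
  qed
  then have ww_pos: "w 0 \<bullet> w 0 > 0"
    using gram ss_nz by (metis zero_less_mult_pos2)
  have m0: "m 0 = w 0 \<bullet> w 0" by (simp add: m_def ww s0)
  have g0: "g 0 = 1" using ww_pos by (simp add: g_def m0)
  have \<alpha>0: "\<alpha> 0 = a" by (simp add: \<alpha>_def g0 w0 s0)
  have u': "(u has_vector_derivative va) (at 0)"
    unfolding u_def by (auto intro!: derivative_eq_intros)
  obtain f' where f': "(f has_real_derivative f') (at 0)"
    using DERIV_divide[OF inner_deriv[OF u' s'] inner_deriv[OF s' s']] s_nz
    unfolding f_def by auto
  obtain c' where c': "(c has_real_derivative c') (at 0)"
    using DERIV_divide[OF DERIV_diff[OF DERIV_add[OF inner_deriv[OF s' s'] DERIV_const] DERIV_const]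
        DERIV_cmult[OF inner_deriv[OF s' s'], of 2]] s_nz
    unfolding c_def by auto
  have w': "(w has_vector_derivative va - (f 0 *\<^sub>R (va + vb) + f' *\<^sub>R s 0)) (at 0)"
    unfolding w_def
    by (intro has_vector_derivative_diff u' scale_deriv s'
        f'[unfolded has_real_derivative_iff_has_vector_derivative])
  obtain m' where m': "(m has_real_derivative m') (at 0)"
    using DERIV_diff[OF DERIV_const DERIV_mult[OF DERIV_power[OF c', of 2] inner_deriv[OF s' s']]]
    unfolding m_def by auto
  have mw: "\<exists>d. ((\<lambda>t. m t / (w t \<bullet> w t)) has_real_derivative d) (at 0)"
    using DERIV_divide[OF m' inner_deriv[OF w' w']] ww_pos by auto
  obtain g' where g': "(g has_real_derivative g') (at 0)"
  proof -
    obtain d where d: "((\<lambda>t. m t / (w t \<bullet> w t)) has_real_derivative d) (at 0)"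
      using mw by blast
    have "m 0 / (w 0 \<bullet> w 0) > 0" using ww_pos by (simp add: m0)
    from DERIV_chain2[OF DERIV_real_sqrt[OF this] d] show ?thesis
      using that unfolding g_def by blast
  qed
  define x where "x = (c 0 *\<^sub>R (va + vb) + c' *\<^sub>R s 0)
    + (g 0 *\<^sub>R (va - (f 0 *\<^sub>R (va + vb) + f' *\<^sub>R s 0)) + g' *\<^sub>R w 0)"
  have \<alpha>': "(\<alpha> has_vector_derivative x) (at 0)"
    unfolding \<alpha>_def x_def
    by (intro has_vector_derivative_add scale_deriv s' w'
        c'[unfolded has_real_derivative_iff_has_vector_derivative]
        g'[unfolded has_real_derivative_iff_has_vector_derivative])
  \<comment> \<open>The neighbourhood includes 0 itself, so that the constraints can be
    differentiated there.\<close>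
  have ev: "\<forall>\<^sub>F t in nhds 0. \<alpha> t \<bullet> \<alpha> t = a \<bullet> a \<and> (s t - \<alpha> t) \<bullet> (s t - \<alpha> t) = b \<bullet> b"
  proof -
    have cont: "isCont (\<lambda>t. s t \<bullet> s t) 0" "isCont (\<lambda>t. w t \<bullet> w t) 0" "isCont m 0"
      using inner_deriv[OF s' s'] inner_deriv[OF w' w'] m' by (auto intro: DERIV_isCont)
    have "\<forall>\<^sub>F t in nhds 0. h t > 0" if "isCont h 0" "h 0 > 0" for h :: "real \<Rightarrow> real"
      using that order_tendstoD(1)[of h "h 0" "nhds 0" 0] by (simp add: continuous_at tendsto_at_iff_tendsto_nhds)
    from this[OF cont(1)] this[OF cont(2)] this[OF cont(3)]
    have "\<forall>\<^sub>F t in nhds 0. s t \<bullet> s t > 0 \<and> w t \<bullet> w t > 0 \<and> m t > 0"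
      using ss_nz ww_pos m0 s0 by (simp add: eventually_conj_iff)
    then show ?thesis
    proof (rule eventually_mono)
      fix t assume t: "s t \<bullet> s t > 0 \<and> w t \<bullet> w t > 0 \<and> m t > 0"
      have sw: "s t \<bullet> w t = 0" using t by (simp add: w_def f_def inner_simps inner_commute)
      have gg: "g t * g t * (w t \<bullet> w t) = m t" using t by (simp add: g_def)
      have cs: "2 * c t * (s t \<bullet> s t) = s t \<bullet> s t + a \<bullet> a - b \<bullet> b"
        using t by (simp add: c_def)
      have "\<alpha> t \<bullet> \<alpha> t = c t * c t * (s t \<bullet> s t) + g t * g t * (w t \<bullet> w t)"
        by (simp add: \<alpha>_def inner_simps inner_commute sw)
      then have 1: "\<alpha> t \<bullet> \<alpha> t = a \<bullet> a" by (simp add: gg m_def power2_eq_square)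
      have "s t \<bullet> \<alpha> t = c t * (s t \<bullet> s t)" by (simp add: \<alpha>_def inner_simps sw)
      then have "(s t - \<alpha> t) \<bullet> (s t - \<alpha> t) = b \<bullet> b"
        using cs by (simp add: inner_simps inner_commute 1)
      then show "\<alpha> t \<bullet> \<alpha> t = a \<bullet> a \<and> (s t - \<alpha> t) \<bullet> (s t - \<alpha> t) = b \<bullet> b" using 1 by simp
    qed
  qed
  text \<open>The constraints determine the components of \<open>x\<close> in the plane of the triangle; the component
    orthogonal to it is that of \<open>va\<close> by construction.\<close>
  have "x \<bullet> a = 0"
  proof -
    have "((\<lambda>t. \<alpha> t \<bullet> \<alpha> t) has_real_derivative 0) (at 0)"
      by (subst DERIV_cong_ev[OF refl _ refl, where g = "\<lambda>_. a \<bullet> a"])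
        (use ev in \<open>auto elim: eventually_mono\<close>)
    from DERIV_unique[OF this inner_deriv[OF \<alpha>' \<alpha>']] show ?thesis
      by (simp add: \<alpha>0 inner_commute)
  qed
  have "(va + vb - x) \<bullet> b = 0"
  proof -
    have "((\<lambda>t. (s t - \<alpha> t) \<bullet> (s t - \<alpha> t)) has_real_derivative 0) (at 0)"
      by (subst DERIV_cong_ev[OF refl _ refl, where g = "\<lambda>_. b \<bullet> b"])
        (use ev in \<open>auto elim: eventually_mono\<close>)
    from DERIV_unique[OF this inner_deriv[OF has_vector_derivative_diff[OF s' \<alpha>']
          has_vector_derivative_diff[OF s' \<alpha>']]] show ?thesis
      by (simp add: \<alpha>0 s0 inner_commute)
  qed
  have "x - va = (c' - f') *\<^sub>R (a + b) + g' *\<^sub>R (a - c 0 *\<^sub>R (a + b))"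
    by (simp add: x_def g0 f0 s0 w0 algebra_simps)
  moreover have "(x - va) \<bullet> a = 0" "(x - va) \<bullet> b = 0"
    using \<open>x \<bullet> a = 0\<close> \<open>(va + vb - x) \<bullet> b = 0\<close> va vb by (simp_all add: inner_simps)
  ultimately have "(x - va) \<bullet> (x - va) = 0"
    by (metis (no_types, lifting) add.right_neutral inner_add_right inner_diff_right
        inner_scaleR_right mult_zero_right diff_zero)
  then have "x = va" by simp
  moreover have "\<forall>\<^sub>F t in at 0. norm (\<alpha> t) = norm a \<and> norm (s t - \<alpha> t) = norm b"
    using ev by (intro eventually_at_filter[THEN iffD2]) (auto elim!: eventually_mono simp: norm_eq_sqrt_inner)
  ultimately show ?thesis using \<alpha>0 \<alpha>' by blast
qed

text \<open>All edges but \<open>a\<close> and \<open>b\<close> move independently on their spheres,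
  and a moving triangle formed by \<open>a\<close> and \<open>b\<close> closes the polygon. This
  does the work of the implicit function theorem at a non-collinear polygon.\<close>

lemma closed_edge_curves:
  fixes e v :: "'i \<Rightarrow> 'a::euclidean_space"
  assumes I: "finite I" "a \<in> I" "b \<in> I" and ab: "\<not> collinear {0, e a, e b}"
    and e: "\<And>i. i \<in> I \<Longrightarrow> e i \<noteq> 0" "(\<Sum>i\<in>I. e i) = 0"
    and v: "\<And>i. i \<in> I \<Longrightarrow> v i \<bullet> e i = 0" "(\<Sum>i\<in>I. v i) = 0"
  shows "\<exists>E. (\<forall>i\<in>I. E 0 i = e i) \<and> (\<forall>t. (\<Sum>i\<in>I. E t i) = 0 \<and> (\<forall>i\<in>I. norm (E t i) = norm (e i))) \<and>
           (\<forall>i\<in>I. ((\<lambda>t :: real. E t i) has_vector_derivative v i) (at 0))"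
proof -
  have "a \<noteq> b" using ab by auto
  have sum_I: "(\<Sum>i\<in>I. f i) = f a + f b + (\<Sum>i\<in>I - {a, b}. f i)" for f :: "'i \<Rightarrow> 'a"
  proof -
    have "(\<Sum>i\<in>I. f i) = f a + (\<Sum>i\<in>I - {a}. f i)"
      by (rule sum.remove[OF I(1,2)])
    also have "(\<Sum>i\<in>I - {a}. f i) = f b + (\<Sum>i\<in>I - {a} - {b}. f i)"
      using I \<open>a \<noteq> b\<close> by (intro sum.remove) auto
    finally have "(\<Sum>i\<in>I. f i) = f a + (f b + (\<Sum>i\<in>I - {a} - {b}. f i))" .
    moreover have "I - {a} - {b} = I - {a, b}" by blast
    ultimately show ?thesis by (simp only: add.assoc)
  qed
  have "\<forall>i\<in>I. \<exists>F. F 0 = e i \<and> (\<forall>t. norm (F t) = norm (e i)) \<and> (F has_vector_derivative v i) (at 0)"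
    using sphere_curve v e by blast
  then obtain F where F0: "\<And>i. i \<in> I \<Longrightarrow> F i 0 = e i"
    and norm_F: "\<And>i t. i \<in> I \<Longrightarrow> norm (F i t) = norm (e i)"
    and F': "\<And>i. i \<in> I \<Longrightarrow> (F i has_vector_derivative v i) (at 0)"
    by metis
  \<comment> \<open>The chord that the edges \<open>a\<close> and \<open>b\<close> have to
    bridge.\<close>
  define s where "s t = - (\<Sum>i\<in>I - {a, b}. F i t)" for t
  have s0: "s 0 = e a + e b"
    using e(2) sum_I[of e] by (simp add: s_def F0) (metis minus_unique add.commute)
  have v_ab: "va + vb = - (\<Sum>i\<in>I - {a, b}. v i)" if "va = v a" "vb = v b" for va vb
    using v(2) sum_I[of v] that by (simp add: eq_neg_iff_add_eq_0)
  have s': "(s has_vector_derivative v a + v b) (at 0)"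
    unfolding s_def v_ab[OF refl refl] by (intro derivative_intros F') auto
  obtain \<alpha> where \<alpha>0: "\<alpha> 0 = e a" and \<alpha>': "(\<alpha> has_vector_derivative v a) (at 0)"
    and norm_\<alpha>: "\<forall>\<^sub>F t in at 0. norm (\<alpha> t) = norm (e a) \<and> norm (s t - \<alpha> t) = norm (e b)"
    using triangle_curve[OF ab v(1)[OF I(2)] v(1)[OF I(3)] s0 s'] by blast
  define C where "C t i = (if i = a then \<alpha> t else if i = b then s t - \<alpha> t else F i t)" for t i
  define good where "good t \<longleftrightarrow> norm (\<alpha> t) = norm (e a) \<and> norm (s t - \<alpha> t) = norm (e b)" for t
  \<comment> \<open>Where the triangle fails to exist the polygon rests in its initial position: the
    curve must be defined for all \<open>t\<close>, and its derivative at 0 is unaffected.\<close>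
  define E where "E t i = (if good t then C t i else e i)" for t i
  have C0: "C 0 i = e i" if "i \<in> I" for i
    using that by (simp add: C_def \<alpha>0 s0 F0)
  have "(\<Sum>i\<in>I. C t i) = 0" for t
  proof -
    have "(\<Sum>i\<in>I - {a, b}. C t i) = (\<Sum>i\<in>I - {a, b}. F i t)"
      by (rule sum.cong) (auto simp: C_def)
    then show ?thesis using \<open>a \<noteq> b\<close> by (simp add: sum_I[of "C t"]) (simp add: C_def s_def)
  qed
  then have "(\<Sum>i\<in>I. E t i) = 0" for t
    using e(2) by (cases "good t") (simp_all add: E_def)
  moreover have "norm (E t i) = norm (e i)" if "i \<in> I" for t i
    using that norm_F by (auto simp: E_def C_def good_def)
  moreover have "((\<lambda>t. E t i) has_vector_derivative v i) (at 0)" if i: "i \<in> I" for i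
  proof -
    have "((\<lambda>t. C t i) has_vector_derivative v i) (at 0)"
      using \<alpha>' has_vector_derivative_diff[OF s' \<alpha>'] F'[OF i]
      by (cases "i = a"; cases "i = b") (simp_all add: C_def)
    moreover have "\<forall>\<^sub>F t in nhds 0. t \<in> UNIV \<longrightarrow> E t i = C t i"
      using norm_\<alpha> C0[OF i]
      by (auto simp: eventually_at_filter E_def good_def \<alpha>0 s0 elim!: eventually_mono)
    ultimately show ?thesis
      using C0[OF i] by (subst has_vector_derivative_cong_ev[where g = "\<lambda>t. C t i"])
        (auto simp: E_def)
  qed
  moreover have "E 0 i = e i" if "i \<in> I" for i using C0[OF that] by (simp add: E_def)
  ultimately show ?thesis by blast
qed

section \<open>Edge vectors and the vertices they determine\<close>

lemma sum_edges:
  fixes P :: "nat \<Rightarrow> 'a::ab_group_add"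
  assumes "n \<ge> 1"
  shows "(\<Sum>i = 1..n. P (nxt n i) - P i) = 0"
  using sum_nxt[OF assms, of P] by (simp add: sum_subtractf)

lemma sum_edges_upto:
  fixes P :: "nat \<Rightarrow> 'a::ab_group_add"
  assumes "i \<in> {1..n}"
  shows "(\<Sum>j = 1..<i. P (nxt n j) - P j) = P i - P 1"
proof -
  have "(\<Sum>j = 1..<i. P (nxt n j) - P j) = (\<Sum>j = 1..<i. P (Suc j) - P j)"
    using assms by (intro sum.cong) (auto simp: nxt_def)
  then show ?thesis using assms by (simp add: sum_Suc_diff')
qed

text \<open>For \<open>i = n\<close> the next index is 1, whose partial sum is empty, and the
  vanishing total closes the gap.\<close>

lemma partial_sums_nxt:
  fixes v :: "nat \<Rightarrow> 'a::ab_group_add"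
  assumes "i \<in> {1..n}" "(\<Sum>j = 1..n. v j) = 0"
  shows "(\<Sum>j = 1..<nxt n i. v j) - (\<Sum>j = 1..<i. v j) = v i"
proof -
  have *: "(\<Sum>j = 1..<Suc i. v j) = (\<Sum>j = 1..<i. v j) + v i"
    using assms(1) by simp
  show ?thesis
  proof (cases "i = n")
    case True
    then have "(\<Sum>j = 1..<i. v j) + v i = 0"
      using * assms(2) by (simp add: atLeastLessThanSuc_atLeastAtMost)
    then show ?thesis using True by (simp add: nxt_def minus_unique)
  next
    case False
    then show ?thesis using * by (simp add: nxt_def)
  qed
qed

lemma config_edge_nonzero:
  assumes "P \<in> config n l" "\<forall>i\<in>{1..n}. l i > 0" "i \<in> {1..n}"
  shows "P (nxt n i) - P i \<noteq> 0"
proof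
  assume "P (nxt n i) - P i = 0"
  moreover have "dist (P i) (P (nxt n i)) = l i" using assms(1,3) by (simp add: config_def)
  moreover have "l i > 0" using assms(2,3) by blast
  ultimately show False by simp
qed

text \<open>If all edges were parallel to the first one, which is nonzero, all vertices would lie on
  a line through \<open>P 1\<close>.\<close>

lemma noncollinear_edges:
  assumes P: "P \<in> config n l" and l: "\<forall>i\<in>{1..n}. l i > 0" and n: "n \<ge> 1"
    and nc: "\<not> collinear (P ` {1..n})"
  shows "\<exists>b\<in>{1..n}. \<not> collinear {0, P (nxt n 1) - P 1, P (nxt n b) - P b}"
proof (rule ccontr)
  assume *: "\<not> ?thesis"
  have "\<exists>k. P (nxt n i) - P i = k *\<^sub>R (P (nxt n 1) - P 1)" if "i \<in> {1..n}" for i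
  proof -
    have "P (nxt n 1) - P 1 \<noteq> 0" using config_edge_nonzero[OF P l, of 1] n by simp
    moreover have "collinear {0, P (nxt n 1) - P 1, P (nxt n i) - P i}" using * that by simp
    ultimately have "P (nxt n i) - P i = 0 \<or> (\<exists>k. P (nxt n i) - P i = k *\<^sub>R (P (nxt n 1) - P 1))"
      unfolding collinear_lemma by simp
    then show ?thesis by (metis scaleR_zero_left)
  qed
  then obtain k where k: "\<And>i. i \<in> {1..n} \<Longrightarrow> P (nxt n i) - P i = k i *\<^sub>R (P (nxt n 1) - P 1)"
    by metis
  have "P i = P 1 + (\<Sum>j = 1..<i. k j) *\<^sub>R (P (nxt n 1) - P 1)" if i: "i \<in> {1..n}" for i
  proof -
    have "P i - P 1 = (\<Sum>j = 1..<i. k j *\<^sub>R (P (nxt n 1) - P 1))"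
      unfolding sum_edges_upto[OF i, of P, symmetric] using i by (intro sum.cong k) auto
    then show ?thesis by (simp add: diff_eq_eq add.commute flip: scaleR_sum_left)
  qed
  then have "collinear (P ` {1..n})" unfolding collinear_alt by blast
  then show False using nc by simp
qed

text \<open>Edge velocities that preserve lengths and closing to first order come from a genuine
  curve of configurations, so criticality can be tested on all such \<open>v\<close>.\<close>

lemma config_tangent_curve:
  fixes P :: "nat \<Rightarrow> real ^ 'd"
  assumes P: "P \<in> config n l" and l: "\<forall>i\<in>{1..n}. l i > 0" and n: "n \<ge> 1"
    and nc: "\<not> collinear (P ` {1..n})"
    and v: "\<And>i. i \<in> {1..n} \<Longrightarrow> v i \<bullet> (P (nxt n i) - P i) = 0" "(\<Sum>i = 1..n. v i) = 0"
  shows "\<exists>\<gamma>. (\<forall>t. \<gamma> t \<in> config n l) \<and> \<gamma> 0 = P \<and>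
           (\<forall>i\<in>{1..n}. ((\<lambda>t :: real. \<gamma> t i) has_vector_derivative (\<Sum>j = 1..<i. v j)) (at 0))"
proof -
  let ?e = "\<lambda>i. P (nxt n i) - P i"
  obtain b where b: "b \<in> {1..n}" "\<not> collinear {0, ?e 1, ?e b}"
    using noncollinear_edges[OF P l n nc] by blast
  have "\<exists>E. (\<forall>i\<in>{1..n}. E 0 i = ?e i) \<and>
      (\<forall>t. (\<Sum>i = 1..n. E t i) = 0 \<and> (\<forall>i\<in>{1..n}. norm (E t i) = norm (?e i))) \<and>
      (\<forall>i\<in>{1..n}. ((\<lambda>t :: real. E t i) has_vector_derivative v i) (at 0))"
    using b(1) n by (intro closed_edge_curves[where a = 1 and b = b and e = ?e, OF _ _ _ b(2)]
        config_edge_nonzero[OF P l]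
        sum_edges v) auto
  then obtain E where E0: "\<And>i. i \<in> {1..n} \<Longrightarrow> E 0 i = ?e i"
    and sum_E: "\<And>t. (\<Sum>i = 1..n. E t i) = 0"
    and norm_E: "\<And>t i. i \<in> {1..n} \<Longrightarrow> norm (E t i) = norm (?e i)"
    and E': "\<And>i. i \<in> {1..n} \<Longrightarrow> ((\<lambda>t. E t i) has_vector_derivative v i) (at (0::real))"
    by blast
  \<comment> \<open>The first vertex stays fixed; the others are reached by summing edges.\<close>
  define \<gamma> where "\<gamma> t = (\<lambda>i\<in>{1..n}. P 1 + (\<Sum>j = 1..<i. E t j))" for t
  have "\<gamma> t \<in> config n l" for t
  proof -
    have "dist (\<gamma> t i) (\<gamma> t (nxt n i)) = l i" if i: "i \<in> {1..n}" for i
    proof -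
      have "\<gamma> t (nxt n i) - \<gamma> t i = E t i"
        using partial_sums_nxt[OF i sum_E] i nxt_in[OF i] by (simp add: \<gamma>_def)
      then have "dist (\<gamma> t i) (\<gamma> t (nxt n i)) = norm (?e i)"
        using norm_E[OF i, of t] by (simp only: dist_norm norm_minus_commute[of "\<gamma> t i"])
      also have "\<dots> = l i" using P i by (simp add: config_def dist_norm norm_minus_commute)
      finally show ?thesis .
    qed
    then show ?thesis by (simp add: config_def \<gamma>_def)
  qed
  moreover have "\<gamma> 0 = P"
  proof
    fix i
    show "\<gamma> 0 i = P i"
    proof (cases "i \<in> {1..n}")
      case True
      have "(\<Sum>j = 1..<i. E 0 j) = (\<Sum>j = 1..<i. ?e j)"
        using True by (intro sum.cong E0) auto
      then show ?thesis using True sum_edges_upto[OF True, of P] by (simp add: \<gamma>_def)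
    next
      case False
      then show ?thesis using P by (auto simp: \<gamma>_def config_def PiE_def extensional_def)
    qed
  qed
  moreover have "((\<lambda>t. \<gamma> t i) has_vector_derivative (\<Sum>j = 1..<i. v j)) (at 0)"
    if "i \<in> {1..n}" for i
  proof -
    have "((\<lambda>t. P 1 + (\<Sum>j = 1..<i. E t j)) has_vector_derivative 0 + (\<Sum>j = 1..<i. v j)) (at 0)"
      using that by (intro has_vector_derivative_add has_vector_derivative_const
          has_vector_derivative_sum E') auto
    then show ?thesis using that by (simp add: \<gamma>_def)
  qed
  ultimately show ?thesis by blast
qed

section \<open>Congruence and the action of words\<close>

lemma or_pres_isometry_compose:
  assumes "or_pres_isometry f" "or_pres_isometry g"
  shows "or_pres_isometry (\<lambda>x. f (g x))"
proof -
  obtain A a B b where A: "rotation_matrix A" "f = (\<lambda>x. A *v x + a)"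
    and B: "rotation_matrix B" "g = (\<lambda>x. B *v x + b)"
    using assms by (auto simp: or_pres_isometry_def)
  have "rotation_matrix (A ** B)"
    using A(1) B(1) by (simp add: rotation_matrix_def orthogonal_matrix_mul det_mul)
  moreover have "(\<lambda>x. f (g x)) = (\<lambda>x. (A ** B) *v x + (A *v b + a))"
    by (simp add: A(2) B(2) matrix_vector_right_distrib matrix_vector_mul_assoc add.assoc)
  ultimately show ?thesis unfolding or_pres_isometry_def by blast
qed

lemma or_pres_isometry_inverse:
  assumes "or_pres_isometry f"
  shows "\<exists>g. or_pres_isometry g \<and> (\<forall>x. g (f x) = x)"
proof -
  obtain A a where A: "rotation_matrix A" "f = (\<lambda>x. A *v x + a)"
    using assms by (auto simp: or_pres_isometry_def)
  let ?g = "\<lambda>x. transpose A *v x + - (transpose A *v a)"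
  have "rotation_matrix (transpose A)"
    using A(1) by (simp add: rotation_matrix_def orthogonal_matrix_transpose)
  then have "or_pres_isometry ?g" unfolding or_pres_isometry_def by blast
  moreover have "?g (f x) = x" for x
    using A(1) by (simp add: A(2) matrix_vector_right_distrib matrix_vector_mul_assoc
        rotation_matrix_def orthogonal_matrix)
  ultimately show ?thesis by blast
qed

lemma congr_PiE:
  "(P, Q) \<in> congr n \<Longrightarrow> P \<in> {1..n} \<rightarrow>\<^sub>E UNIV \<and> Q \<in> {1..n} \<rightarrow>\<^sub>E UNIV"
  by (auto simp: congr_def)

lemma congr_sym:
  assumes "(P, Q) \<in> congr n"
  shows "(Q, P) \<in> congr n"
proof -
  obtain f where f: "or_pres_isometry f" "Q = (\<lambda>i\<in>{1..n}. f (P i))"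
    using assms by (auto simp: congr_def)
  obtain g where g: "or_pres_isometry g" "\<And>x. g (f x) = x"
    using or_pres_isometry_inverse[OF f(1)] by blast
  have "P = (\<lambda>i\<in>{1..n}. g (Q i))"
    using congr_PiE[OF assms] by (fastforce simp: f(2) g(2) PiE_def extensional_def)
  then show ?thesis using congr_PiE[OF assms] g(1) by (auto simp: congr_def)
qed

lemma congr_trans:
  assumes "(P, Q) \<in> congr n" "(Q, R) \<in> congr n"
  shows "(P, R) \<in> congr n"
proof -
  obtain f g where f: "or_pres_isometry f" "Q = (\<lambda>i\<in>{1..n}. f (P i))"
    and g: "or_pres_isometry g" "R = (\<lambda>i\<in>{1..n}. g (Q i))"
    using assms by (auto simp: congr_def)
  have "R = (\<lambda>i\<in>{1..n}. g (f (P i)))" by (auto simp: f(2) g(2))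
  then show ?thesis
    using or_pres_isometry_compose[OF g(1) f(1)] congr_PiE[OF assms(1)] by (auto simp: congr_def)
qed

lemma cls_eq: "(P, Q) \<in> congr n \<Longrightarrow> cls n P = cls n Q"
  unfolding cls_def using congr_sym congr_trans by blast

section \<open>Swaps as involutions, and words read letter by letter\<close>

lemma swap_map_swap_map:
  assumes n: "n \<ge> 3" and i: "i \<in> {1..n}" and x: "x \<in> moduli_union n l"
  shows "swap_map n l i (swap_map n l i x) = x"
proof -
  obtain \<sigma> X where \<sigma>: "x = (\<sigma>, X)" by force
  have "swap_map n l i x \<in> moduli_union n l"
    using swap_map_Bij[OF n i, of l] x by (auto dest: Bij_imp_funcset)
  moreover have "swap_perm n i \<circ> (swap_perm n i \<circ> \<sigma>) = \<sigma>"
    by (simp add: swap_perm_def fun_eq_iff)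
  ultimately show ?thesis
    using x by (simp add: swap_map_def \<sigma> image_image swap_swap[OF n i])
qed

text \<open>Since swaps are involutions, \<open>(i, True)\<close> and \<open>(i, False)\<close> act
  in the same way, and \<open>swap_action_Cons\<close> can treat both at once.\<close>

lemma inv_swap_map:
  fixes n :: nat and l :: "nat \<Rightarrow> real"
  defines "E \<equiv> moduli_union n l :: ((nat \<Rightarrow> nat) \<times> (nat \<Rightarrow> real ^ 'd) set) set"
  assumes n: "n \<ge> 3" and i: "i \<in> {1..n}"
  shows "inv\<^bsub>BijGroup E\<^esub> swap_map n l i = swap_map n l i"
proof (rule group.inv_equality[OF group_BijGroup])
  have B: "swap_map n l i \<in> Bij E" unfolding E_def by (rule swap_map_Bij[OF n i])
  then show "swap_map n l i \<otimes>\<^bsub>BijGroup E\<^esub> swap_map n l i = \<one>\<^bsub>BijGroup E\<^esub>"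
    by (simp add: BijGroup_def compose_def swap_map_swap_map[OF n i] E_def cong: restrict_cong)
  show "swap_map n l i \<in> carrier (BijGroup E)" "swap_map n l i \<in> carrier (BijGroup E)"
    using B by (simp_all add: BijGroup_def)
qed

lemma inv_swap_perm:
  assumes n: "n \<ge> 3" and i: "i \<in> {1..n}"
  shows "inv\<^bsub>sym_group n\<^esub> swap_perm n i = swap_perm n i"
proof (rule group.inv_equality[OF sym_group_is_group])
  show "swap_perm n i \<otimes>\<^bsub>sym_group n\<^esub> swap_perm n i = \<one>\<^bsub>sym_group n\<^esub>"
    by (simp add: sym_group_mult sym_group_one swap_perm_def fun_eq_iff)
qed (use swap_perm_permutes[OF n i] in \<open>simp_all add: sym_group_carrier\<close>)

lemma swap_proj_Nil: "swap_proj n [] = id"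
  by (simp add: swap_proj_def free_lift_def sym_group_one)

lemma swap_proj_Cons:
  assumes "n \<ge> 3" "i \<in> {1..n}"
  shows "swap_proj n ((i, b) # w) = swap_perm n i \<circ> swap_proj n w"
  by (simp add: swap_proj_def free_lift_def sym_group_mult inv_swap_perm[OF assms])

lemma swap_proj_permutes:
  assumes "n \<ge> 3" "set w \<subseteq> {1..n} \<times> UNIV"
  shows "swap_proj n w permutes {1..n}"
  using free_lift_closed[OF sym_group_is_group[of n], where A = "{1..n}" and f = "swap_perm n" and w = w]
    assms swap_perm_permutes by (simp add: swap_proj_def sym_group_carrier)

lemma swap_action_Nil:
  "x \<in> moduli_union n l \<Longrightarrow> swap_action n l [] x = x"
  by (simp add: swap_action_def free_lift_def BijGroup_def)

lemma swap_action_Cons: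
  fixes x :: "(nat \<Rightarrow> nat) \<times> (nat \<Rightarrow> real ^ 'd) set"
  assumes n: "n \<ge> 3" and i: "i \<in> {1..n}" and w: "set w \<subseteq> {1..n} \<times> UNIV"
    and x: "x \<in> moduli_union n l"
  shows "swap_action n l ((i, b) # w) x = swap_map n l i (swap_action n l w x)"
proof -
  let ?B = "BijGroup (moduli_union n l :: ((nat \<Rightarrow> nat) \<times> (nat \<Rightarrow> real ^ 'd) set) set)"
  have gen: "swap_map n l j \<in> carrier ?B" if "j \<in> {1..n}" for j
    using swap_map_Bij[OF n that] by (simp add: BijGroup_def)
  have "swap_action n l w \<in> carrier ?B"
    unfolding swap_action_def using free_lift_closed[OF group_BijGroup gen w] .
  moreover have "swap_action n l ((i, b) # w) = swap_map n l i \<otimes>\<^bsub>?B\<^esub> swap_action n l w"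
    by (simp add: swap_action_def free_lift_def inv_swap_map[OF n i])
  ultimately show ?thesis
    using gen[OF i] x by (simp add: BijGroup_def compose_def)
qed

lemma permuted_id: "permuted id f = f"
  by (simp add: permuted_def)

lemma permuted_swap_perm:
  assumes "n \<ge> 3" "i \<in> {1..n}" "\<sigma> permutes {1..n}"
  shows "permuted (swap_perm n i \<circ> \<sigma>) f = permuted (swap_perm n i) (permuted \<sigma> f)"
  using assms(3) swap_perm_permutes[OF assms(1,2)]
  by (simp add: permuted_def fun_eq_iff o_inv_distrib permutes_bij)

text \<open>Coinciding neighbours would make the two edges at vertex \<open>i\<close> equally long.
  This is where the pairwise different lengths enter.\<close>

lemma config_neighbours_distinct:
  assumes n: "n \<ge> 3" and i: "i \<in> {1..n}" and \<sigma>: "\<sigma> permutes {1..n}"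
    and inj: "inj_on l {1..n}" and P: "P \<in> config n (permuted \<sigma> l)"
  shows "P (prv n i) \<noteq> P (nxt n i)"
proof
  note ci = cyclic_indices[OF n i]
  assume "P (prv n i) = P (nxt n i)"
  moreover have "dist (P (prv n i)) (P i) = l (Hilbert_Choice.inv \<sigma> (prv n i))"
    "dist (P i) (P (nxt n i)) = l (Hilbert_Choice.inv \<sigma> i)"
    using P ci i by (force simp: config_def permuted_def)+
  ultimately have "l (Hilbert_Choice.inv \<sigma> (prv n i)) = l (Hilbert_Choice.inv \<sigma> i)"
    by (simp add: dist_commute)
  then have "Hilbert_Choice.inv \<sigma> (prv n i) = Hilbert_Choice.inv \<sigma> i"
    by (rule inj_onD[OF inj]) (use ci(1) i permutes_in_image[OF permutes_inv[OF \<sigma>]] in blast)+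
  then show False using permutes_inv[OF \<sigma>] ci(3) by (metis permutes_inverses(1) \<sigma>)
qed

section \<open>Critical configurations and screw motions\<close>

text \<open>The plane is the case \<open>u = 0\<close>. The last axiom says that the range of \<open>J\<close> is at most
  two-dimensional.\<close>

locale quarter_turn =
  fixes J :: "real ^ 'd \<Rightarrow> real ^ 'd" and u :: "real ^ 'd"
  assumes linear_J: "linear J"
    and skew: "J x \<bullet> x = 0"
    and J_J: "J (J x) = (x \<bullet> u) *\<^sub>R u - x"
    and J_u: "J u = 0"
    and planar: "(J x \<bullet> J x) *\<^sub>R J y = (J x \<bullet> J y) *\<^sub>R J x + (J (J x) \<bullet> J y) *\<^sub>R J (J x)"
begin

lemma
  shows J_add: "J (x + y) = J x + J y"
    and J_diff: "J (x - y) = J x - J y"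
    and J_scale: "J (k *\<^sub>R x) = k *\<^sub>R J x"
    and J_0: "J 0 = 0"
  using linear_J by (simp_all add: linear_add linear_diff linear_cmul linear_0)

lemmas J_simps = J_add J_diff J_scale J_0

lemma skew': "J x \<bullet> y = - (x \<bullet> J y)"
  using skew[of "x + y"] skew[of x] skew[of y] by (simp add: J_add inner_simps inner_commute)

lemma J_axis: "J x \<bullet> u = 0" "u \<bullet> J x = 0"
  by (simp_all add: skew' J_u) (metis skew' J_u inner_zero_left neg_equal_0_iff_equal)

lemma J_J_J: "J (J (J x)) = - J x"
  by (simp add: J_J[of "J x"] J_axis)

text \<open>Skewness allows only the real eigenvalue 0, and orthogonally to the axis
  \<open>J\<close> squares to minus the identity. This makes the next vertex unique in
  \<open>screw_polygon_congr\<close>.\<close>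

lemma J_eq_scale_imp:
  assumes "J x = \<kappa> *\<^sub>R x" "x \<bullet> u = 0"
  shows "x = 0"
proof -
  have "\<kappa> * (x \<bullet> x) = 0" using assms(1) skew[of x] by simp
  then have "\<kappa> = 0 \<or> x = 0" by auto
  moreover have "J (J x) = - x" using assms(2) by (simp add: J_J)
  ultimately show ?thesis using assms(1) by (auto simp: J_simps)
qed

text \<open>In the plane this is the signed area, in space the component of the vector area along
  \<open>u\<close>.\<close>

definition area_form :: "nat \<Rightarrow> (nat \<Rightarrow> real ^ 'd) \<Rightarrow> real" where
  "area_form n P = (\<Sum>i = 1..n. J (P i) \<bullet> P (nxt n i)) / 2"

text \<open>Summation by parts around the polygon turns the derivative in the vertex velocities into
  one in the edge velocities \<open>v\<close>.\<close>

lemma area_form_derivative: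
  assumes n: "n \<ge> 1" and v: "(\<Sum>i = 1..n. v i) = 0"
    and \<gamma>: "\<And>i. i \<in> {1..n} \<Longrightarrow> ((\<lambda>t :: real. \<gamma> t i) has_vector_derivative (\<Sum>j = 1..<i. v j)) (at 0)"
  shows "((\<lambda>t. area_form n (\<gamma> t)) has_real_derivative
           (\<Sum>i = 1..n. J (\<gamma> 0 i + \<gamma> 0 (nxt n i)) \<bullet> v i) / 2) (at 0)"
proof -
  define w where "w i = (\<Sum>j = 1..<i. v j)" for i
  have J: "bounded_linear J" using linear_J by (simp add: linear_conv_bounded_linear)
  have "((\<lambda>t. J (\<gamma> t i) \<bullet> \<gamma> t (nxt n i)) has_vector_derivative
          J (\<gamma> 0 i) \<bullet> w (nxt n i) + J (w i) \<bullet> \<gamma> 0 (nxt n i)) (at 0)" if i: "i \<in> {1..n}" for i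
    unfolding w_def
    by (intro bounded_bilinear.has_vector_derivative[OF bounded_bilinear_inner]
        bounded_linear.has_vector_derivative[OF J] \<gamma> nxt_in i)
  then have "((\<lambda>t. \<Sum>i = 1..n. J (\<gamma> t i) \<bullet> \<gamma> t (nxt n i)) has_vector_derivative
      (\<Sum>i = 1..n. J (\<gamma> 0 i) \<bullet> w (nxt n i) + J (w i) \<bullet> \<gamma> 0 (nxt n i))) (at 0)"
    by (rule has_vector_derivative_sum)
  moreover have "(\<Sum>i = 1..n. J (\<gamma> 0 i) \<bullet> w (nxt n i) + J (w i) \<bullet> \<gamma> 0 (nxt n i))
      = (\<Sum>i = 1..n. J (\<gamma> 0 i + \<gamma> 0 (nxt n i)) \<bullet> v i)"
  proof -
    \<comment> \<open>The last bracket is a difference of consecutive terms and cancels in the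
      cyclic sum.\<close>
    have "J (\<gamma> 0 i + \<gamma> 0 (nxt n i)) \<bullet> v i
        = J (\<gamma> 0 i) \<bullet> w (nxt n i) + J (w i) \<bullet> \<gamma> 0 (nxt n i)
          + (J (\<gamma> 0 (nxt n i)) \<bullet> w (nxt n i) - J (\<gamma> 0 i) \<bullet> w i)" if "i \<in> {1..n}" for i
      using partial_sums_nxt[OF that v, folded w_def, symmetric]
      by (simp add: J_add inner_simps) (simp add: skew' inner_commute)
    then show ?thesis
      using sum_nxt[OF n, of "\<lambda>i. J (\<gamma> 0 i) \<bullet> w i"] by (simp add: sum.distrib sum_subtractf)
  qed
  ultimately show ?thesis
    unfolding area_form_def by (intro DERIV_cdivide) (simp add: has_real_derivative_iff_has_vector_derivative)
qed

text \<open>The multiplier lemma is applied to the edges, with the gradient read off from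
  \<open>area_form_derivative\<close>.\<close>

lemma critical_multipliers:
  assumes n: "n \<ge> 1" and l: "\<forall>i\<in>{1..n}. l i > 0" and P: "P \<in> config n l"
    and nc: "\<not> collinear (P ` {1..n})"
    and crit: "\<And>\<gamma>. (\<And>t. \<gamma> t \<in> config n l) \<Longrightarrow> \<gamma> 0 = P \<Longrightarrow>
      (\<And>i. i \<in> {1..n} \<Longrightarrow> (\<lambda>t. \<gamma> t i) differentiable (at 0)) \<Longrightarrow>
      ((\<lambda>t. area_form n (\<gamma> t)) has_real_derivative 0) (at 0)"
  shows "\<exists>c \<mu>. \<forall>i\<in>{1..n}. J (P i + P (nxt n i)) = c + \<mu> i *\<^sub>R (P (nxt n i) - P i)"
proof -
  let ?e = "\<lambda>i. P (nxt n i) - P i"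
  obtain b where b: "b \<in> {1..n}" "\<not> collinear {0, ?e 1, ?e b}"
    using noncollinear_edges[OF P l n nc] by blast
  have "(\<Sum>i = 1..n. J (P i + P (nxt n i)) \<bullet> v i) = 0"
    if v: "\<And>i. i \<in> {1..n} \<Longrightarrow> v i \<bullet> ?e i = 0" "(\<Sum>i = 1..n. v i) = 0" for v
  proof -
    obtain \<gamma> where \<gamma>: "\<And>t. \<gamma> t \<in> config n l" "\<gamma> 0 = P"
      "\<And>i. i \<in> {1..n} \<Longrightarrow> ((\<lambda>t :: real. \<gamma> t i) has_vector_derivative (\<Sum>j = 1..<i. v j)) (at 0)"
      using config_tangent_curve[OF P l n nc v] by metis
    have "((\<lambda>t. area_form n (\<gamma> t)) has_real_derivative 0) (at 0)"
      using \<gamma> by (intro crit) (auto intro: differentiableI_vector)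
    then show ?thesis
      using DERIV_unique[OF area_form_derivative[OF n v(2) \<gamma>(3)]] \<gamma>(2) by force
  qed
  then show ?thesis
    using b n by (intro lagrange_multipliers[where a = 1 and b = b and e = ?e]) auto
qed

text \<open>The edges are chords of screw motions about the common axis \<open>u\<close>; the screw motion of the
  edge \<open>i\<close> is determined by \<open>\<mu> i\<close> (the cotangent of half the angle) and the pitch \<open>h i\<close>, which is
  redundant unless \<open>\<mu> i = 0\<close>.\<close>

definition screw_polygon ::
    "nat \<Rightarrow> real ^ 'd \<Rightarrow> real \<Rightarrow> (nat \<Rightarrow> real) \<Rightarrow> (nat \<Rightarrow> real) \<Rightarrow> (nat \<Rightarrow> real ^ 'd) \<Rightarrow> bool" where
  "screw_polygon n c r \<mu> h P \<longleftrightarrow>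
     (\<forall>i\<in>{1..n}. J (P i + P (nxt n i)) = c + \<mu> i *\<^sub>R (P (nxt n i) - P i) \<and>
        (P (nxt n i) - P i) \<bullet> u = h i \<and> norm (J (P i)) = r)"

section \<open>Chords of screw motions and their swaps\<close>

text \<open>Applying \<open>J\<close> removes \<open>c\<close>, and skewness makes
  \<open>J (p + q)\<close> orthogonal to \<open>J (q - p)\<close>. Geometrically, both ends have the
  same distance from the axis.\<close>

lemma chord_norm:
  assumes "J (p + q) = c + \<mu> *\<^sub>R (q - p)" "J c = 0"
  shows "norm (J p) = norm (J q)"
proof -
  have "J (J (p + q)) = \<mu> *\<^sub>R J (q - p)" using assms by (simp add: J_simps)
  then have "J (J (p + q)) \<bullet> (q - p) = 0" using skew[of "q - p"] by simp
  then have "J (p + q) \<bullet> J (q - p) = 0" using skew'[of "J (p + q)"] by simp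
  then show ?thesis
    by (simp add: J_simps inner_simps inner_commute norm_eq_sqrt_inner)
qed

text \<open>The heart of the proof: the reflected vertex is the one reached when the two screw
  motions are applied in the opposite order. Everything follows from the relation between \<tau>,
  \<kappa> and \<mu>, where \<tau> measures the displacement of \<open>b\<close> along
  \<open>d - a\<close>.\<close>

lemma screw_swap:
  fixes a b d \<kappa> \<mu> c
  defines "b' \<equiv> bisector_reflection a d b"
  assumes ab: "J (a + b) = c + \<kappa> *\<^sub>R (b - a)" and bd: "J (b + d) = c + \<mu> *\<^sub>R (d - b)"
    and "a \<noteq> d"
  shows "J (a + b') = c + \<mu> *\<^sub>R (b' - a)" "J (b' + d) = c + \<kappa> *\<^sub>R (d - b')"
    "(b' - a) \<bullet> u = (d - b) \<bullet> u" "(d - b') \<bullet> u = (b - a) \<bullet> u"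
proof -
  define x where "x = b - a"
  define y where "y = d - a"
  define \<tau> where "\<tau> = 2 * ((b - midpoint a d) \<bullet> y) / (y \<bullet> y)"
  have y: "y \<bullet> y \<noteq> 0" using \<open>a \<noteq> d\<close> by (simp add: y_def)
  have b': "b' = b - \<tau> *\<^sub>R y" by (simp add: b'_def bisector_reflection_def \<tau>_def y_def)
  have "b - midpoint a d = x - (1/2) *\<^sub>R y"
    by (simp add: x_def y_def midpoint_def algebra_simps flip: scaleR_add_left)
  then have \<tau>: "\<tau> * (y \<bullet> y) = 2 * (x \<bullet> y) - y \<bullet> y"
    using y by (simp add: \<tau>_def inner_simps)
  \<comment> \<open>The difference of the two chord equations no longer contains
    \<open>c\<close>.\<close>
  have Jy: "J y = \<mu> *\<^sub>R y - (\<kappa> + \<mu>) *\<^sub>R x"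
  proof -
    have "J y = J (b + d) - J (a + b)" by (simp add: y_def J_simps)
    then show ?thesis by (simp add: ab bd x_def y_def algebra_simps)
  qed
  \<comment> \<open>Pairing with \<open>y\<close> and using skewness expresses the foot of the
    altitude through the multipliers.\<close>
  have "(\<kappa> + \<mu>) * (x \<bullet> y) = \<mu> * (y \<bullet> y)"
    using skew[of y] by (simp add: Jy inner_simps)
  then have "(\<kappa> + \<mu>) * (2 * (x \<bullet> y) - y \<bullet> y) = (\<mu> - \<kappa>) * (y \<bullet> y)"
    by (simp add: algebra_simps)
  then have "((\<kappa> + \<mu>) * \<tau>) * (y \<bullet> y) = (\<mu> - \<kappa>) * (y \<bullet> y)"
    by (simp add: mult.assoc flip: \<tau>)
  then have \<tau>_eq: "(\<kappa> + \<mu>) * \<tau> = \<mu> - \<kappa>" using y by simp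
  have s: "(\<kappa> * \<tau>) *\<^sub>R z = (\<mu> - \<kappa> - \<mu> * \<tau>) *\<^sub>R z" for z :: "real ^ 'd"
  proof -
    have "\<kappa> * \<tau> = \<mu> - \<kappa> - \<mu> * \<tau>" using \<tau>_eq by (simp add: algebra_simps)
    then show ?thesis by simp
  qed
  have d: "d = a + y" and b: "b = a + x" by (simp_all add: x_def y_def)
  have "J (a + b') = c + \<kappa> *\<^sub>R x - \<tau> *\<^sub>R J y"
    using ab by (simp add: b' J_simps b algebra_simps)
  also have "\<dots> = c + \<mu> *\<^sub>R (b' - a)"
    using s[of x] by (simp add: Jy b' b algebra_simps)
  finally show 1: "J (a + b') = c + \<mu> *\<^sub>R (b' - a)" .
  have "J (b' + d) = J (a + b') + J y" by (simp add: d J_simps)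
  also have "\<dots> = c + \<kappa> *\<^sub>R (d - b')"
    unfolding 1 using s[of y] by (simp add: Jy b' b d algebra_simps)
  finally show "J (b' + d) = c + \<kappa> *\<^sub>R (d - b')" .
  \<comment> \<open>The equation for \<tau> again, with the axis \<open>u\<close> in place of the
    second factor \<open>y\<close>.\<close>
  have h: "2 * (x \<bullet> u) - y \<bullet> u = \<tau> * (y \<bullet> u)"
  proof (cases "\<kappa> + \<mu> = 0")
    \<comment> \<open>Both multipliers vanish here: two half turns compose to a translation along
      the axis, so \<open>y\<close> is parallel to \<open>u\<close>.\<close>
    case True
    then have "\<mu> = \<kappa>" using \<tau>_eq by simp
    then have "J y = 0" using True Jy by simp
    then have "y = (y \<bullet> u) *\<^sub>R u" using J_J[of y] by (simp add: J_0)
    then have yz: "z \<bullet> y = (y \<bullet> u) * (z \<bullet> u)" for z by (metis inner_scaleR_right)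
    have "y \<bullet> u \<noteq> 0" using y yz[of y] by auto
    moreover have "(y \<bullet> u) * (2 * (x \<bullet> u) - y \<bullet> u) = (y \<bullet> u) * (\<tau> * (y \<bullet> u))"
      using \<tau> unfolding yz[of x] yz[of y] by (simp add: algebra_simps)
    ultimately show ?thesis by simp
  next
    case False
    have "(\<kappa> + \<mu>) * (x \<bullet> u) = \<mu> * (y \<bullet> u)"
      using J_axis(1)[of y] by (simp add: Jy inner_simps)
    then have "(\<kappa> + \<mu>) * (2 * (x \<bullet> u) - y \<bullet> u) = (\<mu> - \<kappa>) * (y \<bullet> u)"
      by (simp add: algebra_simps)
    also have "\<dots> = (\<kappa> + \<mu>) * (\<tau> * (y \<bullet> u))" by (simp add: mult.assoc flip: \<tau>_eq)
    finally have "(\<kappa> + \<mu>) * (2 * (x \<bullet> u) - y \<bullet> u) = (\<kappa> + \<mu>) * (\<tau> * (y \<bullet> u))" .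
    then show ?thesis using False by simp
  qed
  then show "(b' - a) \<bullet> u = (d - b) \<bullet> u" "(d - b') \<bullet> u = (b - a) \<bullet> u"
    by (simp_all add: b' b d inner_simps)
qed

text \<open>The parameters travel with the edges while axis and radius stay, which gives the
  invariant to be carried along a word.\<close>

lemma screw_polygon_swap:
  assumes n: "n \<ge> 3" and i: "i \<in> {1..n}" and ne: "P (prv n i) \<noteq> P (nxt n i)" and c: "J c = 0"
    and P: "screw_polygon n c r \<mu> h P"
  shows "screw_polygon n c r (permuted (swap_perm n i) \<mu>) (permuted (swap_perm n i) h) (swap n i P)"
proof -
  note ci = cyclic_indices[OF n i]
  have chord: "J (P j + P (nxt n j)) = c + \<mu> j *\<^sub>R (P (nxt n j) - P j)"
    and pitch: "(P (nxt n j) - P j) \<bullet> u = h j" and radius: "norm (J (P j)) = r"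
    if "j \<in> {1..n}" for j
    using P that by (auto simp: screw_polygon_def)
  note S = screw_swap[OF chord[OF ci(1), unfolded ci(6)] chord[OF i] ne]
  have "norm (J (swap n i P j)) = r" if j: "j \<in> {1..n}" for j
  proof (cases "j = i")
    case True
    then show ?thesis using chord_norm[OF S(1) c] radius[OF ci(1)] by (simp add: swap_def)
  next
    case False
    then show ?thesis using radius[OF j] by (simp add: swap_def)
  qed
  moreover have "J (swap n i P j + swap n i P (nxt n j)) =
        c + permuted (swap_perm n i) \<mu> j *\<^sub>R (swap n i P (nxt n j) - swap n i P j) \<and>
      (swap n i P (nxt n j) - swap n i P j) \<bullet> u = permuted (swap_perm n i) h j"
    if j: "j \<in> {1..n}" for j
  proof -
    consider "j = i" | "j = prv n i" | "j \<noteq> i" "nxt n j \<noteq> i" "j \<noteq> prv n i"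
      using i j by (force simp: nxt_def prv_def split: if_splits)
    then show ?thesis
      using ci S chord[OF j] pitch[OF i] pitch[OF ci(1)] pitch[OF j]
      by cases (simp_all add: swap_def permuted_def swap_perm_def)
  qed
  ultimately show ?thesis by (simp add: screw_polygon_def)
qed

section \<open>Rotations about the axis\<close>

text \<open>Rodrigues' formula; for \<open>u = 0\<close> it is the usual rotation of the
  plane.\<close>

definition rot :: "real \<Rightarrow> real ^ 'd \<Rightarrow> real ^ 'd" where
  "rot \<theta> x = x + (1 - cos \<theta>) *\<^sub>R J (J x) + sin \<theta> *\<^sub>R J x"

lemma linear_rot: "linear (rot \<theta>)"
  by (rule linearI) (simp_all add: rot_def J_simps algebra_simps)

lemma J_rot: "J (rot \<theta> x) = rot \<theta> (J x)"
  by (simp add: rot_def J_simps J_J_J)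

lemma rot_kernel: "J x = 0 \<Longrightarrow> rot \<theta> x = x"
  by (simp add: rot_def J_0)

lemma rot_axis: "rot \<theta> x \<bullet> u = x \<bullet> u"
  by (simp add: rot_def inner_simps J_axis)

lemma J_rot': "J (rot \<theta> x) = cos \<theta> *\<^sub>R J x + sin \<theta> *\<^sub>R J (J x)"
  by (simp add: rot_def J_simps J_J_J algebra_simps)

lemma J_J_rot: "J (J (rot \<theta> x)) = cos \<theta> *\<^sub>R J (J x) - sin \<theta> *\<^sub>R J x"
  by (simp add: J_rot' J_simps J_J_J)

lemma rot_rot: "rot \<theta> (rot \<phi> x) = rot (\<theta> + \<phi>) x"
  unfolding rot_def[of \<theta>] J_J_rot unfolding J_rot'
  by (simp add: rot_def cos_add sin_add algebra_simps)

lemma norm_rot: "norm (rot \<theta> x) = norm x"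
proof -
  have 1: "J x \<bullet> J (J x) = 0" "x \<bullet> J x = 0" using skew[of "J x"] skew[of x] by (simp_all add: inner_commute)
  have 2: "x \<bullet> J (J x) = - (J x \<bullet> J x)" using skew'[of x "J x"] by simp
  have 3: "J (J x) \<bullet> J (J x) = J x \<bullet> J x" using skew'[of "J x" "J (J x)"] by (simp add: J_J_J)
  have 4: "cos \<theta> * (cos \<theta> * q) + sin \<theta> * (sin \<theta> * q) = q" for q
    using sin_cos_squared_add3[of \<theta>] by (metis distrib_right mult.assoc mult_1)
  have "rot \<theta> x \<bullet> rot \<theta> x = x \<bullet> x"
    by (simp add: rot_def inner_simps inner_commute 1 2 3 4 algebra_simps)
  then show ?thesis by (simp add: norm_eq_sqrt_inner)
qed

text \<open>The determinant is a square because \<open>rot \<theta>\<close> is the square of \<open>rot (\<theta> / 2)\<close>.\<close>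

lemma rotation_matrix_rot: "rotation_matrix (matrix (rot \<theta>))"
proof -
  have orth: "orthogonal_matrix (matrix (rot \<phi>))" for \<phi>
    using orthogonal_transformation orthogonal_transformation_matrix linear_rot norm_rot by blast
  have "rot \<theta> = rot (\<theta>/2) \<circ> rot (\<theta>/2)" by (simp add: fun_eq_iff rot_rot)
  then have "matrix (rot \<theta>) = matrix (rot (\<theta>/2)) ** matrix (rot (\<theta>/2))"
    using matrix_compose[OF linear_rot linear_rot] by metis
  then have "det (matrix (rot \<theta>)) = (det (matrix (rot (\<theta>/2))))\<^sup>2"
    by (simp add: det_mul power2_eq_square)
  also have "\<dots> = 1" using det_orthogonal_matrix[OF orth[of "\<theta>/2"]] by auto
  finally show ?thesis using orth by (simp add: rotation_matrix_def)
qed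

lemma or_pres_isometry_screw: "or_pres_isometry (\<lambda>x. rot \<theta> x + t)"
  unfolding or_pres_isometry_def
  using rotation_matrix_rot[of \<theta>] fun_cong[OF matrix_vector_mul(2)[OF linear_rot]] by metis

text \<open>\<open>J x\<close> and \<open>J y\<close> lie on one circle in the range of
  \<open>J\<close>. The coordinates of \<open>J y\<close> in the orthogonal frame
  \<open>J x\<close>, \<open>J (J x)\<close> are a cosine and a sine, and the remaining difference
  lies in the kernel of \<open>J\<close>.\<close>

lemma screw_transitive:
  assumes "norm (J x) = norm (J y)"
  shows "\<exists>\<theta> t. rot \<theta> x + t = y \<and> J t = 0"
proof -
  have "\<exists>\<theta>. J y = J (rot \<theta> x)"
  proof (cases "J x = 0")
    case True
    then show ?thesis using assms by (simp add: J_rot' J_0)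
  next
    case False
    define q where "q = J x \<bullet> J x"
    have q: "q \<noteq> 0" using False by (simp add: q_def)
    have qy: "J y \<bullet> J y = q" using assms by (simp add: q_def norm_eq_sqrt_inner)
    have e: "q *\<^sub>R J y = (J x \<bullet> J y) *\<^sub>R J x + (J (J x) \<bullet> J y) *\<^sub>R J (J x)"
      using planar[of x y] by (simp add: q_def)
    define \<alpha> where "\<alpha> = (J x \<bullet> J y) / q"
    define \<beta> where "\<beta> = (J (J x) \<bullet> J y) / q"
    have "J y \<bullet> (q *\<^sub>R J y) = (J x \<bullet> J y)\<^sup>2 + (J (J x) \<bullet> J y)\<^sup>2"
      unfolding e by (simp add: inner_simps inner_commute power2_eq_square)
    then have "(J x \<bullet> J y)\<^sup>2 + (J (J x) \<bullet> J y)\<^sup>2 = q\<^sup>2"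
      by (simp add: qy power2_eq_square)
    moreover have "\<alpha>\<^sup>2 + \<beta>\<^sup>2 = ((J x \<bullet> J y)\<^sup>2 + (J (J x) \<bullet> J y)\<^sup>2) / q\<^sup>2"
      by (simp add: \<alpha>_def \<beta>_def power_divide add_divide_distrib)
    ultimately have "\<alpha>\<^sup>2 + \<beta>\<^sup>2 = 1" using q by simp
    then obtain \<theta> where "\<alpha> = cos \<theta>" "\<beta> = sin \<theta>" using sincos_total_2pi by metis
    moreover have "J y = \<alpha> *\<^sub>R J x + \<beta> *\<^sub>R J (J x)"
    proof -
      have "J y = (1 / q) *\<^sub>R (q *\<^sub>R J y)" using q by simp
      then show ?thesis unfolding e by (simp add: \<alpha>_def \<beta>_def scaleR_add_right)
    qed
    ultimately show ?thesis by (auto simp: J_rot')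
  qed
  then obtain \<theta> where "J y = J (rot \<theta> x)" by blast
  then show ?thesis by (intro exI[of _ \<theta>] exI[of _ "y - rot \<theta> x"]) (simp add: J_simps)
qed

text \<open>A screw motion takes \<open>P 1\<close> to \<open>Q 1\<close>. It commutes with
  \<open>J\<close> and fixes \<open>c\<close>, so the image of \<open>P\<close> solves the same
  equations as \<open>Q\<close>, and these determine each vertex from the previous one.\<close>

lemma screw_polygon_congr:
  assumes n: "n \<ge> 1" and c: "J c = 0" and PE: "P \<in> {1..n} \<rightarrow>\<^sub>E UNIV" "Q \<in> {1..n} \<rightarrow>\<^sub>E UNIV"
    and P: "screw_polygon n c r \<mu> h P" and Q: "screw_polygon n c r \<mu> h Q"
  shows "(P, Q) \<in> congr n"
proof -
  have "norm (J (P 1)) = norm (J (Q 1))" using P Q n by (simp add: screw_polygon_def)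
  then obtain \<theta> t where t: "rot \<theta> (P 1) + t = Q 1" "J t = 0" using screw_transitive by blast
  define g where "g = (\<lambda>x. rot \<theta> x + t)"
  have J_g: "J (g x) = rot \<theta> (J x)" for x by (simp add: g_def J_add t(2) J_rot)
  have gP: "J (g (P i) + g (P (nxt n i))) = c + \<mu> i *\<^sub>R (g (P (nxt n i)) - g (P i))"
    "(g (P (nxt n i)) - g (P i)) \<bullet> u = h i" if i: "i \<in> {1..n}" for i
  proof -
    have Pi: "J (P i + P (nxt n i)) = c + \<mu> i *\<^sub>R (P (nxt n i) - P i)"
      "(P (nxt n i) - P i) \<bullet> u = h i"
      using P i by (auto simp: screw_polygon_def)
    have "J (g (P i) + g (P (nxt n i))) = rot \<theta> (J (P i + P (nxt n i)))"
      by (simp add: J_add J_g linear_add[OF linear_rot])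
    then show "J (g (P i) + g (P (nxt n i))) = c + \<mu> i *\<^sub>R (g (P (nxt n i)) - g (P i))"
      unfolding Pi(1)
      by (simp add: g_def linear_add[OF linear_rot] linear_diff[OF linear_rot]
          linear_cmul[OF linear_rot] rot_kernel[OF c])
    show "(g (P (nxt n i)) - g (P i)) \<bullet> u = h i"
      using Pi(2) by (simp add: g_def inner_simps rot_axis)
  qed
  have "i \<in> {1..n} \<Longrightarrow> g (P i) = Q i" for i
  proof (induction i)
    case (Suc i)
    show ?case
    proof (cases "i = 0")
      case True
      then show ?thesis using t by (simp add: g_def)
    next
      case False
      then have i: "i \<in> {1..n}" "nxt n i = Suc i" using Suc.prems by (auto simp: nxt_def)
      then have IH: "g (P i) = Q i" using Suc.IH by simp
      have "J (Q i + Q (Suc i)) = c + \<mu> i *\<^sub>R (Q (Suc i) - Q i)" "(Q (Suc i) - Q i) \<bullet> u = h i"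
        using Q i(1) by (auto simp: screw_polygon_def simp flip: i(2))
      note Qi = this gP[OF i(1), unfolded i(2) IH]
      \<comment> \<open>Two candidates for the next vertex differ by an eigenvector of
        \<open>J\<close> orthogonal to the axis.\<close>
      have "J (g (P (Suc i)) - Q (Suc i)) = J (Q i + g (P (Suc i))) - J (Q i + Q (Suc i))"
        by (simp add: J_simps)
      also have "\<dots> = \<mu> i *\<^sub>R (g (P (Suc i)) - Q (Suc i))"
        unfolding Qi by (simp add: algebra_simps)
      finally have "J (g (P (Suc i)) - Q (Suc i)) = \<mu> i *\<^sub>R (g (P (Suc i)) - Q (Suc i))" .
      moreover have "(g (P (Suc i)) - Q (Suc i)) \<bullet> u = 0"
        using Qi(2,4) by (simp add: inner_simps)
      ultimately show ?thesis using J_eq_scale_imp by fastforce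
    qed
  qed simp
  then have "Q = (\<lambda>i\<in>{1..n}. g (P i))" using PE(2) by (fastforce simp: PiE_def extensional_def)
  then show ?thesis using PE(1) or_pres_isometry_screw unfolding congr_def g_def by blast
qed

section \<open>Words of swaps acting on screw polygons\<close>

text \<open>Induction on the word, following one representative \<open>Q\<close> whose lengths,
  multipliers and pitches are all permuted alike.\<close>

lemma swap_action_screw_polygon:
  assumes n: "n \<ge> 3" and inj: "inj_on l {1..n}" and c: "J c = 0"
    and P: "P \<in> config n l" "screw_polygon n c r \<mu> h P"
    and w: "set w \<subseteq> {1..n} \<times> UNIV"
  defines "\<sigma> \<equiv> swap_proj n"
  shows "\<exists>Q\<in>config n (permuted (\<sigma> w) l).
      screw_polygon n c r (permuted (\<sigma> w) \<mu>) (permuted (\<sigma> w) h) Q \<and>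
      swap_action n l w (id, cls n P) = (\<sigma> w, cls n Q)"
  using w
proof (induction w)
  have E: "(id, cls n P) \<in> moduli_union n l"
    using P(1) by (auto simp: moduli_union_def sym_group_carrier permutes_id permuted_def moduli_def
        cls_def intro: quotientI)
  {
    case Nil
    show ?case
      unfolding \<sigma>_def swap_proj_Nil permuted_id using P swap_action_Nil[OF E] by blast
  next
    case (Cons x w)
    obtain i b where x: "x = (i, b)" and i: "i \<in> {1..n}" and w: "set w \<subseteq> {1..n} \<times> UNIV"
      using Cons.prems by (cases x) auto
    obtain Q where Q: "Q \<in> config n (permuted (\<sigma> w) l)"
      "screw_polygon n c r (permuted (\<sigma> w) \<mu>) (permuted (\<sigma> w) h) Q"
      "swap_action n l w (id, cls n P) = (\<sigma> w, cls n Q)"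
      using Cons.IH[OF w] by blast
    have perm: "\<sigma> w permutes {1..n}" unfolding \<sigma>_def by (rule swap_proj_permutes[OF n w])
    have \<sigma>: "\<sigma> (x # w) = swap_perm n i \<circ> \<sigma> w" unfolding x \<sigma>_def by (rule swap_proj_Cons[OF n i])
    note permuted = permuted_swap_perm[OF n i perm, folded \<sigma>]
    have QE: "(\<sigma> w, cls n Q) \<in> moduli_union n l"
      using Q(1) perm by (auto simp: moduli_union_def sym_group_carrier moduli_def
        cls_def intro: quotientI)
    have "swap_action n l (x # w) (id, cls n P) = swap_map n l i (\<sigma> w, cls n Q)"
      unfolding x swap_action_Cons[OF n i w E] Q(3) ..
    also have "\<dots> = (\<sigma> (x # w), cls n (swap n i Q))"
      using QE by (simp add: swap_map_def \<sigma> swap_cls[OF n i Q(1)])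
    finally have "swap_action n l (x # w) (id, cls n P) = (\<sigma> (x # w), cls n (swap n i Q))" .
    moreover have "swap n i Q \<in> config n (permuted (\<sigma> (x # w)) l)"
      unfolding permuted by (rule swap_config[OF n i Q(1)])
    moreover have "screw_polygon n c r (permuted (\<sigma> (x # w)) \<mu>) (permuted (\<sigma> (x # w)) h) (swap n i Q)"
      unfolding permuted
      by (rule screw_polygon_swap[OF n i config_neighbours_distinct[OF n i perm inj Q(1)] c Q(2)])
    ultimately show ?case by blast
  }
qed

text \<open>A word in the kernel returns every parameter to its edge, so the final polygon is
  congruent to the initial one.\<close>

lemma pure_swaps_fix_screw_polygon:
  assumes n: "n \<ge> 3" and inj: "inj_on l {1..n}" and c: "J c = 0"
    and P: "P \<in> config n l" "screw_polygon n c r \<mu> h P" and g: "g \<in> pure_swaps n"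
  shows "swap_action n l g (id, cls n P) = (id, cls n P)"
proof -
  have g': "set g \<subseteq> {1..n} \<times> UNIV" "swap_proj n g = id"
    using g by (auto simp: pure_swaps_def kernel_def free_group_def sym_group_one)
  obtain Q where Q: "Q \<in> config n l" "screw_polygon n c r \<mu> h Q"
    "swap_action n l g (id, cls n P) = (id, cls n Q)"
    using swap_action_screw_polygon[OF n inj c P g'(1)] unfolding g'(2) permuted_id by blast
  have "(P, Q) \<in> congr n"
    using n by (intro screw_polygon_congr[OF _ c _ _ P(2) Q(2)]) (use P Q in \<open>auto simp: config_def\<close>)
  then show ?thesis using Q(3) cls_eq by metis
qed

text \<open>The origin is moved onto the axis; \<open>chord_norm\<close> then propagates the radius
  from vertex to vertex, and the pitches are read off the polygon.\<close>

lemma screw_polygon_translate: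
  assumes n: "n \<ge> 1"
    and P: "\<And>i. i \<in> {1..n} \<Longrightarrow> J (P i + P (nxt n i)) = c + \<mu> i *\<^sub>R (P (nxt n i) - P i)"
  shows "\<exists>t c r h. J c = 0 \<and> screw_polygon n c r \<mu> h (\<lambda>i\<in>{1..n}. P i + t)"
proof -
  \<comment> \<open>Translation by \<open>t\<close> adds \<open>2 *\<^sub>R J t\<close> to
    \<open>c\<close>; this \<open>t\<close> leaves only the component of \<open>c\<close> along the
    axis.\<close>
  define t where "t = (1/2) *\<^sub>R J c"
  define c' where "c' = c + 2 *\<^sub>R J t"
  define Q where "Q = (\<lambda>i\<in>{1..n}. P i + t)"
  have c': "J c' = 0" by (simp add: c'_def t_def J_simps J_J_J)
  have chord: "J (Q i + Q (nxt n i)) = c' + \<mu> i *\<^sub>R (Q (nxt n i) - Q i)" if i: "i \<in> {1..n}" for i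
  proof -
    have "Q i + Q (nxt n i) = P i + P (nxt n i) + 2 *\<^sub>R t"
      using i nxt_in[OF i] by (simp add: Q_def scaleR_2)
    then have "J (Q i + Q (nxt n i)) = J (P i + P (nxt n i)) + 2 *\<^sub>R J t"
      by (simp only: J_add[of _ "2 *\<^sub>R t"] J_scale)
    then show ?thesis using i nxt_in[OF i] by (simp add: P c'_def Q_def)
  qed
  have "i \<in> {1..n} \<Longrightarrow> norm (J (Q i)) = norm (J (Q 1))" for i
  proof (induction i)
    case (Suc i)
    show ?case
    proof (cases "i = 0")
      case False
      then have "i \<in> {1..n}" "nxt n i = Suc i" using Suc.prems by (auto simp: nxt_def)
      then show ?thesis using chord_norm[OF chord[of i] c'] Suc.IH by simp
    qed simp
  qed simp
  then have "screw_polygon n c' (norm (J (Q 1))) \<mu> (\<lambda>i. (Q (nxt n i) - Q i) \<bullet> u) Q"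
    unfolding screw_polygon_def using chord by blast
  then show ?thesis using c' unfolding Q_def by blast
qed

lemma pure_swaps_fix_critical:
  assumes n: "n \<ge> 3" and l: "\<forall>i\<in>{1..n}. l i > 0" and inj: "inj_on l {1..n}"
    and P: "P \<in> config n l" and nc: "\<not> collinear (P ` {1..n})"
    and crit: "\<And>\<gamma>. (\<And>t. \<gamma> t \<in> config n l) \<Longrightarrow> \<gamma> 0 = P \<Longrightarrow>
      (\<And>i. i \<in> {1..n} \<Longrightarrow> (\<lambda>t. \<gamma> t i) differentiable (at 0)) \<Longrightarrow>
      ((\<lambda>t. area_form n (\<gamma> t)) has_real_derivative 0) (at 0)"
    and g: "g \<in> pure_swaps n"
  shows "swap_action n l g (id, cls n P) = (id, cls n P)"
proof -
  have "n \<ge> 1" using n by simp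
  have "\<exists>c \<mu>. \<forall>i\<in>{1..n}. J (P i + P (nxt n i)) = c + \<mu> i *\<^sub>R (P (nxt n i) - P i)"
    by (rule critical_multipliers[OF \<open>n \<ge> 1\<close> l P nc]) (rule crit)
  then obtain c \<mu> where "\<forall>i\<in>{1..n}. J (P i + P (nxt n i)) = c + \<mu> i *\<^sub>R (P (nxt n i) - P i)"
    by (elim exE)
  then obtain t c' r h where c': "J c' = 0" and Q: "screw_polygon n c' r \<mu> h (\<lambda>i\<in>{1..n}. P i + t)"
    using screw_polygon_translate[OF \<open>n \<ge> 1\<close>, of P c \<mu>] by (metis (no_types, lifting))
  have "(\<lambda>i\<in>{1..n}. P i + t) \<in> config n l"
    using P nxt_in[of _ n] by (auto simp: config_def dist_norm)
  moreover have "(P, \<lambda>i\<in>{1..n}. P i + t) \<in> congr n"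
  proof -
    have "or_pres_isometry (\<lambda>x :: real ^ 'd. x + t)"
      using or_pres_isometry_screw[of 0 t] by (simp add: rot_def)
    then show ?thesis using P by (auto simp: congr_def config_def)
  qed
  ultimately show ?thesis
    using pure_swaps_fix_screw_polygon[OF n inj c' _ Q g] cls_eq by metis
qed

end


section \<open>The plane and space\<close>

definition turn2 :: "real ^ 2 \<Rightarrow> real ^ 2" where
  "turn2 x = vector [- x $ 2, x $ 1]"

interpretation plane: quarter_turn turn2 0
proof (rule quarter_turn.intro)
  show "linear turn2"
    by (rule linearI) (simp_all add: turn2_def vec_eq_iff forall_2)
qed (simp_all add: turn2_def vec_eq_iff forall_2 inner_vec_def sum_2 algebra_simps)

lemma plane_area_form: "plane.area_form n P = signed_area n P"
  by (simp add: plane.area_form_def signed_area_def turn2_def inner_vec_def sum_2 algebra_simps)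

text \<open>For the planarity axiom, two vectors \<open>v\<close> and \<open>z\<close> orthogonal to
  \<open>u\<close> have a cross product along \<open>u\<close>; the double product of
  \<open>v\<close>, \<open>v\<close>, \<open>z\<close> is then expanded in two ways.\<close>

lemma quarter_turn_cross3:
  assumes u: "u \<bullet> u = 1"
  shows "quarter_turn (cross3 u) u"
proof (rule quarter_turn.intro)
  show J_J: "cross3 u (cross3 u x) = (x \<bullet> u) *\<^sub>R u - x" for x
    by (simp add: Lagrange u inner_commute)
  show "linear (cross3 u)" using bilinear_cross by (simp add: bilinear_def)
  show "cross3 u x \<bullet> x = 0" for x by (simp add: dot_cross_self)
  show "cross3 u u = 0" by simp
  fix x y
  define v where "v = cross3 u x"
  define z where "z = cross3 u y"
  have [simp]: "u \<bullet> v = 0" "u \<bullet> z = 0" by (simp_all add: v_def z_def dot_cross_self)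
  have "cross3 v (cross3 v z) = (v \<bullet> z) *\<^sub>R v - (v \<bullet> v) *\<^sub>R z" by (simp add: Lagrange)
  moreover have "cross3 v z = ((cross3 v z) \<bullet> u) *\<^sub>R u"
    using J_J[of "cross3 v z"] by (simp add: Lagrange[of u v z])
  then have "cross3 v (cross3 v z) = ((cross3 v z) \<bullet> u) *\<^sub>R cross3 v u"
    by (metis cross_mult_right)
  ultimately have "(v \<bullet> v) *\<^sub>R z = (v \<bullet> z) *\<^sub>R v + ((cross3 v z) \<bullet> u) *\<^sub>R cross3 u v"
    by (simp add: cross_skew[of v u] algebra_simps)
  moreover have "(cross3 v z) \<bullet> u = cross3 u v \<bullet> z" by (metis cross_triple)
  ultimately show "(cross3 u x \<bullet> cross3 u x) *\<^sub>R cross3 u y = (cross3 u x \<bullet> cross3 u y) *\<^sub>R cross3 u x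
      + (cross3 u (cross3 u x) \<bullet> cross3 u y) *\<^sub>R cross3 u (cross3 u x)"
    by (simp add: v_def z_def)
qed

lemma space_area_form:
  assumes "u \<bullet> u = 1"
  shows "quarter_turn.area_form (cross3 u) n P = u \<bullet> vector_area n P"
proof -
  have "cross3 u p \<bullet> q = u \<bullet> cross3 p q" for p q by (metis cross_triple inner_commute)
  then show ?thesis
    by (simp add: quarter_turn.area_form_def[OF quarter_turn_cross3[OF assms]] vector_area_def
        inner_sum_right)
qed

text \<open>Differentiability of the whole vector, not just of its norm, allows passing from the
  norm to the component along a fixed direction.\<close>

lemma vector_area_differentiable:
  assumes "\<And>i. i \<in> {1..n} \<Longrightarrow> (\<lambda>t :: real. \<gamma> t i) differentiable (at 0)"
  shows "\<exists>V. ((\<lambda>t. vector_area n (\<gamma> t)) has_vector_derivative V) (at 0)"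
proof -
  have "\<forall>i\<in>{1..n}. \<exists>d. ((\<lambda>t. \<gamma> t i) has_vector_derivative d) (at 0)"
    using assms vector_derivative_works by blast
  then obtain d where d: "\<And>i. i \<in> {1..n} \<Longrightarrow> ((\<lambda>t. \<gamma> t i) has_vector_derivative d i) (at 0)"
    by metis
  have "bounded_bilinear cross3" using bilinear_cross by (simp add: bilinear_conv_bounded_bilinear)
  note cross_deriv = bounded_bilinear.has_vector_derivative[OF this]
  have "((\<lambda>t. vector_area n (\<gamma> t)) has_vector_derivative (1 / 2) *\<^sub>R
      (\<Sum>i = 1..n. cross3 (\<gamma> 0 i) (d (nxt n i)) + cross3 (d i) (\<gamma> 0 (nxt n i)))) (at 0)"
    unfolding vector_area_def
    by (intro bounded_linear.has_vector_derivative[OF bounded_linear_scaleR_right]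
        has_vector_derivative_sum cross_deriv d nxt_in)
  then show ?thesis by blast
qed

lemma critical_point_representative:
  assumes "critical_point n l F X"
  obtains P where "P \<in> config n l" "cls n P = X" "\<not> collinear (P ` {1..n})"
proof -
  have X: "X \<in> moduli n l" and nc: "\<forall>P\<in>X. \<not> collinear (P ` {1..n})"
    using assms by (auto simp: critical_point_def)
  obtain P where P: "P \<in> config n l" "X = cls n P"
    using X by (auto simp: moduli_def cls_def elim: quotientE)
  have "(\<lambda>i\<in>{1..n}. P i) = P" using P(1) by (auto simp: config_def dest: PiE_restrict)
  then have "P \<in> X"
    using P or_pres_isometry_id by (force simp: cls_def congr_def config_def)
  then show ?thesis using that P nc by blast
qed

theorem proposition3p9:
  fixes n :: nat and l :: "nat \<Rightarrow> real"
  assumes "n \<ge> 3"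
    and "\<forall>i\<in>{1..n}. l i > 0"
    and "inj_on l {1..n}"
  shows "(\<forall>X :: (nat \<Rightarrow> real ^ 2) set. critical_point n l (area_M2 n) X \<longrightarrow>
            (\<forall>g\<in>pure_swaps n. swap_action n l g (id, X) = (id, X))) \<and>
         (\<forall>X :: (nat \<Rightarrow> real ^ 3) set. critical_point n l (area_M3 n) X \<and> area_M3 n X \<noteq> 0 \<longrightarrow>
            (\<forall>g\<in>pure_swaps n. swap_action n l g (id, X) = (id, X)))"
proof (intro conjI allI impI ballI)
  have n: "n \<ge> 1" using assms(1) by simp
  fix X :: "(nat \<Rightarrow> real ^ 2) set" and g
  assume X: "critical_point n l (area_M2 n) X" and g: "g \<in> pure_swaps n"
  obtain P where P: "P \<in> config n l" "cls n P = X" "\<not> collinear (P ` {1..n})"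
    using critical_point_representative[OF X] .
  have "((\<lambda>t. plane.area_form n (\<gamma> t)) has_real_derivative 0) (at 0)"
    if \<gamma>: "\<And>t. \<gamma> t \<in> config n l" "\<gamma> 0 = P"
      "\<And>i. i \<in> {1..n} \<Longrightarrow> (\<lambda>t. \<gamma> t i) differentiable (at 0)" for \<gamma>
  proof -
    have "((\<lambda>t. area_M2 n (cls n (\<gamma> t))) has_real_derivative 0) (at 0)"
      using X \<gamma> P(2) by (simp add: critical_point_def)
    then show ?thesis by (simp add: area_M2_cls[OF n \<gamma>(1)] plane_area_form)
  qed
  then show "swap_action n l g (id, X) = (id, X)"
    using plane.pure_swaps_fix_critical[OF assms P(1,3) _ g] P(2) by blast
next
  have n: "n \<ge> 1" using assms(1) by simp
  fix X :: "(nat \<Rightarrow> real ^ 3) set" and g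
  assume X: "critical_point n l (area_M3 n) X \<and> area_M3 n X \<noteq> 0" and g: "g \<in> pure_swaps n"
  obtain P where P: "P \<in> config n l" "cls n P = X" "\<not> collinear (P ` {1..n})"
    using critical_point_representative X by blast
  have nz: "vector_area n P \<noteq> 0" using X area_M3_cls[OF n P(1)] P(2) by auto
  \<comment> \<open>The direction is frozen at the critical configuration, so that
    \<open>cross3 u\<close> does not vary along curves.\<close>
  define u where "u = sgn (vector_area n P)"
  have u: "u \<bullet> u = 1" using nz by (simp add: u_def norm_sgn flip: power2_norm_eq_inner)
  have "((\<lambda>t. quarter_turn.area_form (cross3 u) n (\<gamma> t)) has_real_derivative 0) (at 0)"
    if \<gamma>: "\<And>t. \<gamma> t \<in> config n l" "\<gamma> 0 = P"
      "\<And>i. i \<in> {1..n} \<Longrightarrow> (\<lambda>t. \<gamma> t i) differentiable (at 0)" for \<gamma>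
  proof -
    obtain V where V: "((\<lambda>t. vector_area n (\<gamma> t)) has_vector_derivative V) (at 0)"
      using vector_area_differentiable[where n = n and \<gamma> = \<gamma>, OF \<gamma>(3)] by blast
    have "((\<lambda>t. area_M3 n (cls n (\<gamma> t))) has_real_derivative 0) (at 0)"
      using X \<gamma> P(2) by (simp add: critical_point_def)
    then have "((\<lambda>t. norm (vector_area n (\<gamma> t))) has_real_derivative 0) (at 0)"
      by (simp add: area_M3_cls[OF n \<gamma>(1)])
    \<comment> \<open>At a nonzero vector the norm and the component along its direction agree to
      first order.\<close>
    moreover have "((\<lambda>t. norm (vector_area n (\<gamma> t))) has_real_derivative V \<bullet> u) (at 0)"
      using has_derivative_compose[OF V[unfolded has_vector_derivative_def] has_derivative_norm] nz
      by (simp add: \<gamma>(2) u_def has_field_derivative_def mult_commute_abs)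
    ultimately have "V \<bullet> u = 0" using DERIV_unique by blast
    moreover have "((\<lambda>t. u \<bullet> vector_area n (\<gamma> t)) has_vector_derivative u \<bullet> V) (at 0)"
      by (rule bounded_linear.has_vector_derivative[OF bounded_linear_inner_right V])
    ultimately show ?thesis
      by (simp add: space_area_form[OF u] has_real_derivative_iff_has_vector_derivative inner_commute)
  qed
  then show "swap_action n l g (id, X) = (id, X)"
    using quarter_turn.pure_swaps_fix_critical[OF quarter_turn_cross3[OF u] assms P(1,3) _ g] P(2)
    by blast
qed

end
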